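(* There is a deterministic CONGESTED CLIQUE algorithm that solves the list-coloring problem on every instance consisting of an $n$-node graph $G=(V,E)$ with maximum degree $\Delta$, a color space $[C]$, and lists $L(v)\subseteq[C]$ with $|L(v)|\ge\deg(v)+1$ for all $v\in V$, in $O(\log\log\Delta\cdot\log C)$ rounds. (In particular, if $C\le\mathrm{poly}(\Delta)$, the number of rounds is $O(\log\Delta\cdot\log\log\Delta)$.)
   Context: $[C]:=\{0,\dots,C-1\}$. Given a graph $G=(V,E)$, a color space $[C]$ and lists $L(v)\subseteq[C]$ for $v\in V$, a list-coloring is a map $\phi:V\to[C]$ with $\phi(v)\in L(v)$ for all $v\in V$ and $\phi(u)\ne\phi(v)$ for every edge $\{u,v\}\in E$. (Unicast) CONGESTED CLIQUE model: the input is a graph $G=(V,E)$ on $n$ nodes with unique $O(\log n)$-bit identifiers. Time proceeds in synchronous rounds; in each round every node $u\in V$ performs arbitrary internal computation and can send a (possibly different) message of $O(\log n)$ bits to every other node $v\in V$, whether or not $\{u,v\}\in E$. Initially each node knows only its own input (its list) and its neighbors in $G$; at the end each node must know its own color. The time complexity is the number of rounds. Standing assumption: $C\le\mathrm{poly}(n)$, so that a color fits into $O(1)$ messages. In asymptotic bounds, logarithmic factors are read as being at least $1$. *)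

theory Defs
  imports Complex_Main
begin

text \<open>Logarithmic factors are read as being at least 1. In particular \<open>lg (lg x)\<close> is
  \<open>log log x\<close> under this convention, also for \<open>x < 2\<close>.\<close>

definition lg :: "real \<Rightarrow> real" where
  "lg x = max 1 (log 2 x)"


subsection \<open>Graphs and list coloring\<close>

text \<open>Nodes are identified with their unique identifiers, which are natural numbers. The type
  imposes no bound on identifiers; it is stated in \<open>short_ids\<close> below.\<close>

definition simple_graph :: "nat set \<Rightarrow> nat set set \<Rightarrow> bool" where
  "simple_graph V E \<longleftrightarrow> finite V \<and> (\<forall>e\<in>E. e \<subseteq> V \<and> card e = 2)"

definition neighbors :: "nat set set \<Rightarrow> nat \<Rightarrow> nat set" where
  "neighbors E v = {u. {u, v} \<in> E}"

definition deg :: "nat set set \<Rightarrow> nat \<Rightarrow> nat" where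
  "deg E v = card (neighbors E v)"

text \<open>The inserted 0 only matters for the graph without nodes.\<close>

definition max_deg :: "nat set \<Rightarrow> nat set set \<Rightarrow> nat" where
  "max_deg V E = Max (insert 0 (deg E ` V))"

definition list_coloring ::
  "nat set \<Rightarrow> nat set set \<Rightarrow> nat \<Rightarrow> (nat \<Rightarrow> nat set) \<Rightarrow> (nat \<Rightarrow> nat) \<Rightarrow> bool" where
  "list_coloring V E C L \<phi> \<longleftrightarrow>
     (\<forall>v\<in>V. \<phi> v \<in> {..<C} \<and> \<phi> v \<in> L v) \<and>
     (\<forall>u v. {u, v} \<in> E \<longrightarrow> \<phi> u \<noteq> \<phi> v)"


subsection \<open>The deterministic (unicast) CONGESTED CLIQUE model\<close>

type_synonym message = "bool list"

text \<open>Everything a node knows: its identifier, the identifiers of its neighbors, its own input, and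
  for each past round (oldest first) the message received from each sender, \<open>None\<close> meaning that
  there is no other node with that identifier. In particular the number of nodes, the maximum
  degree and the color space are not given initially. Since internal computation is
  unrestricted, any state a deterministic node could keep is a function of this view, so
  no separate state space is needed.\<close>

record 'i view =
  own_id :: nat
  nbr_ids :: "nat set"
  own_input :: 'i
  received :: "(nat \<Rightarrow> message option) list"

text \<open>\<open>send A w v\<close> is the message that a node with view \<open>w\<close> sends to node \<open>v\<close> in the next round.
  \<open>result A w\<close> is \<open>None\<close> as long as the node is undecided.\<close>

record ('i, 'o) algorithm =
  send :: "'i view \<Rightarrow> nat \<Rightarrow> message"
  result :: "'i view \<Rightarrow> 'o option"

text \<open>\<open>view_after A V E inp t v\<close> is the view of node \<open>v\<close> after \<open>t\<close> rounds. Messages travel between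
  all pairs of distinct nodes; \<open>E\<close> enters only through the initial knowledge.\<close>

primrec view_after ::
  "('i, 'o) algorithm \<Rightarrow> nat set \<Rightarrow> nat set set \<Rightarrow> (nat \<Rightarrow> 'i) \<Rightarrow> nat \<Rightarrow> nat \<Rightarrow> 'i view" where
  "view_after A V E inp 0 = (\<lambda>v.
     \<lparr>own_id = v, nbr_ids = neighbors E v, own_input = inp v, received = []\<rparr>)"
| "view_after A V E inp (Suc t) = (\<lambda>v.
     (view_after A V E inp t v)
       \<lparr>received := received (view_after A V E inp t v) @
          [\<lambda>u. if u \<in> V \<and> u \<noteq> v then Some (send A (view_after A V E inp t u) v) else None]\<rparr>)"

definition short_ids :: "nat \<Rightarrow> nat set \<Rightarrow> bool" where
  "short_ids a V \<longleftrightarrow> (\<forall>v\<in>V. real v < 2 powr (real a * lg (real (card V))))"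

definition respects_bandwidth ::
  "nat \<Rightarrow> ('i, 'o) algorithm \<Rightarrow> nat set \<Rightarrow> nat set set \<Rightarrow> (nat \<Rightarrow> 'i) \<Rightarrow> bool" where
  "respects_bandwidth b A V E inp \<longleftrightarrow>
     (\<forall>t. \<forall>u\<in>V. \<forall>v\<in>V. u \<noteq> v \<longrightarrow>
        real (length (send A (view_after A V E inp t u) v)) \<le> real b * lg (real (card V)))"

text \<open>The first output of a node is irrevocable; later values of \<open>result\<close> are ignored. A node may
  still send messages after it has decided.\<close>

definition decides_after ::
  "nat \<Rightarrow> ('i, 'o) algorithm \<Rightarrow> nat set \<Rightarrow> nat set set \<Rightarrow> (nat \<Rightarrow> 'i) \<Rightarrow> nat \<Rightarrow> 'o \<Rightarrow> bool" where
  "decides_after t A V E inp v x \<longleftrightarrow>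
     result A (view_after A V E inp t v) = Some x \<and>
     (\<forall>s<t. result A (view_after A V E inp s v) = None)"


subsection \<open>List coloring in the CONGESTED CLIQUE\<close>

text \<open>Instances of (degree+1)-list coloring. The constant \<open>a\<close> bounds the identifiers and
  \<open>p\<close> is the constant of the standing assumption that \<open>C\<close> is polynomial in the number of
  nodes; every polynomial in \<open>n \<ge> 1\<close> is at most \<open>p * n ^ p\<close> for some \<open>p\<close>.\<close>

definition coloring_instance ::
  "nat \<Rightarrow> nat \<Rightarrow> nat set \<Rightarrow> nat set set \<Rightarrow> nat \<Rightarrow> (nat \<Rightarrow> nat set) \<Rightarrow> bool" where
  "coloring_instance a p V E C L \<longleftrightarrow>
     simple_graph V E \<and> short_ids a V \<and> C \<le> p * card V ^ p \<and>
     (\<forall>v\<in>V. L v \<subseteq> {..<C} \<and> card (L v) \<ge> deg E v + 1)"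

definition solves_within ::
  "nat \<Rightarrow> (nat set, nat) algorithm \<Rightarrow> nat set \<Rightarrow> nat set set \<Rightarrow> nat \<Rightarrow> (nat \<Rightarrow> nat set) \<Rightarrow> bool"
  where
  "solves_within T A V E C L \<longleftrightarrow>
     (\<exists>\<phi>. list_coloring V E C L \<phi> \<and> (\<forall>v\<in>V. \<exists>t\<le>T. decides_after t A V E L v (\<phi> v)))"

end

theory Submission
  imports Defs "HOL-Library.Log_Nat"
begin

text \<open>The colors of the active nodes are fixed digit by digit in some base \<open>B\<close>: every active node
  narrows its list to the colors with a common digit prefix, choosing the next digit with
  probability proportional to the number of remaining colors. With (nearly) pairwise independent
  choices, the sum over all active nodes of conflicting neighbors divided by remaining colors hardly
  grows in expectation. It is at most the number \<open>m\<close> of active nodes initially, so at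
  the end there are at most about \<open>m / 2\<close> conflicting edges, and the nodes that have no conflicting
  neighbor of smaller identifier, at least \<open>m / 4\<close> of them, keep their colors. A seed of
  \<open>O(log n)\<close> bits suffices; it is found by the method of conditional expectations, one base-\<open>n\<close>
  digit in two rounds, node \<open>i\<close> of the clique being responsible for the digit value \<open>i\<close>.

  When \<open>m\<close> nodes are active, each of them can inform the whole clique about \<open>n / m\<close> numbers in two
  rounds, which allows the base \<open>B = 1 + n div m\<close>. As \<open>m\<close> decreases geometrically, phase \<open>i\<close> takes
  \<open>O(1 + log C / max 1 i)\<close> rounds. After \<open>O(log \<Delta>)\<close> phases, \<open>m \<Delta> = O(n)\<close>, and the remaining
  instance is made known to everyone. The harmonic sum gives the bound.\<close>


section \<open>Programs with public state\<close>

text \<open>\<open>Ask a b k\<close> takes two rounds: node \<open>u\<close> sends \<open>a u (input of u) w\<close> to each \<open>w\<close>, and then node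
  \<open>w\<close> broadcasts the number that \<open>b\<close> computes from what it has received. Everything that is broadcast
  is known to all nodes, so they all agree on the rest of the program. A node's input
  consists of its neighbors and its list.\<close>

type_synonym local_input = "nat set \<times> nat set"

datatype 'x prog =
    Ret 'x
  | Ask "nat \<Rightarrow> local_input \<Rightarrow> nat \<Rightarrow> nat" "nat \<Rightarrow> local_input \<Rightarrow> (nat \<Rightarrow> nat) \<Rightarrow> nat"
      "(nat \<Rightarrow> nat) \<Rightarrow> 'x prog"

primrec bind :: "'x prog \<Rightarrow> ('x \<Rightarrow> 'y prog) \<Rightarrow> 'y prog" where
  "bind (Ret x) f = f x"
| "bind (Ask a b k) f = Ask a b (\<lambda>r. bind (k r) f)"

text \<open>Reduction modulo \<open>Z\<close> models truncated messages; later
  \<open>Z = 2 ^ width c V\<close>. The correctness proofs therefore show that every number sent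
  stays below \<open>Z\<close>.\<close>

definition relayed :: "nat set \<Rightarrow> (nat \<Rightarrow> local_input) \<Rightarrow> nat \<Rightarrow> (nat \<Rightarrow> local_input \<Rightarrow> nat \<Rightarrow> nat) \<Rightarrow> nat \<Rightarrow> nat \<Rightarrow> nat" where
  "relayed V P Z a w = (\<lambda>u. if u \<in> V then a u (P u) w mod Z else 0)"

definition answer :: "nat set \<Rightarrow> (nat \<Rightarrow> local_input) \<Rightarrow> nat \<Rightarrow> (nat \<Rightarrow> local_input \<Rightarrow> nat \<Rightarrow> nat) \<Rightarrow>
    (nat \<Rightarrow> local_input \<Rightarrow> (nat \<Rightarrow> nat) \<Rightarrow> nat) \<Rightarrow> nat \<Rightarrow> nat" where
  "answer V P Z a b = (\<lambda>w. if w \<in> V then b w (P w) (relayed V P Z a w) mod Z else 0)"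

primrec value_of :: "nat set \<Rightarrow> (nat \<Rightarrow> local_input) \<Rightarrow> nat \<Rightarrow> 'x prog \<Rightarrow> 'x" where
  "value_of V P Z (Ret x) = x"
| "value_of V P Z (Ask a b k) = value_of V P Z (k (answer V P Z a b))"

primrec steps_of :: "nat set \<Rightarrow> (nat \<Rightarrow> local_input) \<Rightarrow> nat \<Rightarrow> 'x prog \<Rightarrow> nat" where
  "steps_of V P Z (Ret x) = 0"
| "steps_of V P Z (Ask a b k) = Suc (steps_of V P Z (k (answer V P Z a b)))"

lemma value_of_bind [simp]:
  "value_of V P Z (bind q f) = value_of V P Z (f (value_of V P Z q))"
  by (induction q) auto

lemma steps_of_bind [simp]:
  "steps_of V P Z (bind q f) = steps_of V P Z q + steps_of V P Z (f (value_of V P Z q))"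
  by (induction q) auto

text \<open>The program left after \<open>k\<close> answered queries. It is the common knowledge
  with which the reconstruction from a single view is compared.\<close>

primrec residual :: "nat set \<Rightarrow> (nat \<Rightarrow> local_input) \<Rightarrow> nat \<Rightarrow> 'x prog \<Rightarrow> nat \<Rightarrow> 'x prog" where
  "residual V P Z q 0 = q"
| "residual V P Z q (Suc k) = (case residual V P Z q k of
     Ret x \<Rightarrow> Ret x | Ask a b c \<Rightarrow> c (answer V P Z a b))"

lemma residual_Ask:
  "residual V P Z (Ask a b c) (Suc k) = residual V P Z (c (answer V P Z a b)) k"
  by (induction k) auto

lemma residual_steps_of: "residual V P Z q (steps_of V P Z q) = Ret (value_of V P Z q)"
proof (induction q)
  case (Ask a b c)
  then show ?case using residual_Ask by (metis rangeI steps_of.simps(2) value_of.simps(2))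
qed auto

lemma residual_before:
  "k < steps_of V P Z q \<Longrightarrow> \<exists>a b c. residual V P Z q k = Ask a b c"
proof (induction q arbitrary: k)
  case (Ask a b c)
  then show ?case
    by (cases k) (auto simp: residual_Ask simp del: residual.simps(2))
qed auto

section \<open>Running programs in the clique\<close>

definition encode :: "nat \<Rightarrow> nat \<Rightarrow> message" where
  "encode l x = map (bit x) [0..<l]"

definition decode :: "message \<Rightarrow> nat" where
  "decode = horner_sum of_bool 2"

lemma decode_encode: "decode (encode l x) = x mod 2 ^ l"
  by (simp add: decode_def encode_def horner_sum_bit_eq_take_bit take_bit_eq_mod)

lemma length_encode [simp]: "length (encode l x) = l"
  by (simp add: encode_def)

definition known_nodes :: "'i view \<Rightarrow> nat set" where
  "known_nodes w = insert (own_id w) {u. (received w ! 0) u \<noteq> None}"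

text \<open>With \<open>n = card V\<close>, \<open>floorlog 2 n\<close> bits represent all of
  \<open>0..n\<close>, so \<open>2 ^ width c V\<close> is at least \<open>(n + 1) ^ c\<close> while
  messages keep O(log n) bits.\<close>

definition width :: "nat \<Rightarrow> nat set \<Rightarrow> nat" where
  "width c V = c * floorlog 2 (card V)"

definition own_private :: "nat set view \<Rightarrow> local_input" where
  "own_private w = (nbr_ids w, own_input w)"

text \<open>A node receives nothing from itself, so its own number \<open>x\<close> is inserted.\<close>

definition heard :: "nat set view \<Rightarrow> nat \<Rightarrow> nat \<Rightarrow> nat \<Rightarrow> nat" where
  "heard w t x = (\<lambda>u. if u = own_id w then x
     else case (received w ! t) u of None \<Rightarrow> 0 | Some m \<Rightarrow> decode m)"

text \<open>The first round only serves to find out who is there; the rounds numbered \<open>1 + 2 * k\<close> and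
  \<open>2 + 2 * k\<close>, counting from 0, belong to the \<open>k\<close>-th query.\<close>

definition first_heard where
  "first_heard c w k a = heard w (1 + 2 * k)
     (a (own_id w) (own_private w) (own_id w) mod 2 ^ width c (known_nodes w))"

definition second_heard where
  "second_heard c w k a b = heard w (2 + 2 * k)
     (b (own_id w) (own_private w) (first_heard c w k a) mod 2 ^ width c (known_nodes w))"

primrec public_state :: "nat \<Rightarrow> (nat set \<Rightarrow> 'x prog) \<Rightarrow> nat set view \<Rightarrow> nat \<Rightarrow> 'x prog" where
  "public_state c q w 0 = q (known_nodes w)"
| "public_state c q w (Suc k) = (case public_state c q w k of
     Ret x \<Rightarrow> Ret x
   | Ask a b f \<Rightarrow> f (second_heard c w k a b))"

definition compile :: "nat \<Rightarrow> (nat set \<Rightarrow> (nat \<Rightarrow> nat) prog) \<Rightarrow> (nat set, nat) algorithm" where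
  "compile c q = \<lparr>
     send = (\<lambda>w v. case length (received w) of
         0 \<Rightarrow> []
       | Suc t \<Rightarrow> (case public_state c q w (t div 2) of
           Ret x \<Rightarrow> []
         | Ask a b f \<Rightarrow> encode (width c (known_nodes w))
             (if even t then a (own_id w) (own_private w) v
              else b (own_id w) (own_private w) (first_heard c w (t div 2) a)))),
     result = (\<lambda>w. case length (received w) of
         0 \<Rightarrow> None
       | Suc t \<Rightarrow> (case public_state c q w (t div 2) of
           Ret x \<Rightarrow> Some (x (own_id w))
         | Ask a b f \<Rightarrow> None))\<rparr>"

lemma send_compile:
  "received w = r \<Longrightarrow> length r = Suc t \<Longrightarrow> send (compile c q) w v =
     (case public_state c q w (t div 2) of
       Ret x \<Rightarrow> []
     | Ask a b f \<Rightarrow> encode (width c (known_nodes w))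
         (if even t then a (own_id w) (own_private w) v
          else b (own_id w) (own_private w) (first_heard c w (t div 2) a)))"
  by (simp add: compile_def)

lemma result_compile:
  "received w = r \<Longrightarrow> length r = Suc t \<Longrightarrow> result (compile c q) w =
     (case public_state c q w (t div 2) of
       Ret x \<Rightarrow> Some (x (own_id w))
     | Ask a b f \<Rightarrow> None)"
  by (simp add: compile_def)

lemma view_after_simps [simp]:
  "own_id (view_after A V E inp t v) = v"
  "nbr_ids (view_after A V E inp t v) = neighbors E v"
  "own_input (view_after A V E inp t v) = inp v"
  "length (received (view_after A V E inp t v)) = t"
  by (induction t) auto

lemma received_nth:
  "i < t \<Longrightarrow> received (view_after A V E inp t v) ! i =
     (\<lambda>u. if u \<in> V \<and> u \<noteq> v then Some (send A (view_after A V E inp i u) v) else None)"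
  by (induction t) (auto simp: nth_append less_Suc_eq)

lemma known_nodes_view_after:
  "v \<in> V \<Longrightarrow> 0 < t \<Longrightarrow> known_nodes (view_after A V E inp t v) = V"
  by (auto simp: known_nodes_def received_nth)

declare view_after.simps(2) [simp del]

section \<open>Simulation: all nodes reconstruct the same program state\<close>

context
  fixes c :: nat and q :: "nat set \<Rightarrow> (nat \<Rightarrow> nat) prog" and V :: "nat set" and E :: "nat set set" and L :: "nat \<Rightarrow> nat set"
begin

abbreviation (input) "vw \<equiv> view_after (compile c q) V E L"
abbreviation (input) "priv \<equiv> \<lambda>v. (neighbors E v, L v)"
abbreviation (input) "ZZ \<equiv> (2::nat) ^ width c V"

text \<open>The hypothesis \<open>*\<close> is the induction hypothesis of
  \<open>public_state_view_after\<close>: in round \<open>1 + 2 * k\<close> all senders evaluate the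
  same query, so their messages decode to \<open>relayed\<close>.\<close>

lemma public_state_first_heard:
  assumes *: "\<And>t v. v \<in> V \<Longrightarrow> 1 + 2 * k \<le> t \<Longrightarrow>
      public_state c q (vw t v) k = residual V priv ZZ (q V) k"
    and r: "residual V priv ZZ (q V) k = Ask a b f"
    and v: "v \<in> V" and t: "2 + 2 * k \<le> t"
  shows "first_heard c (vw t v) k a = relayed V priv ZZ a v"
proof -
  have s: "send (compile c q) (vw (1 + 2 * k) u) v = encode (width c V) (a u (priv u) v)"
    if "u \<in> V" for u
    using *[of u "1 + 2 * k"] that r
    by (simp add: send_compile[OF refl] known_nodes_view_after own_private_def)
  show ?thesis
    using v t s
    by (auto simp: first_heard_def heard_def relayed_def received_nth known_nodes_view_after
        own_private_def decode_encode fun_eq_iff)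
qed

text \<open>Answers are broadcast, so every node feeds the same function \<open>answer\<close> to
  the continuation. The bound on \<open>t\<close> says that the discovery round and two rounds per
  query have passed.\<close>

lemma public_state_view_after:
  "v \<in> V \<Longrightarrow> 1 + 2 * k \<le> t \<Longrightarrow> public_state c q (vw t v) k = residual V priv ZZ (q V) k"
proof (induction k arbitrary: t v)
  case 0
  then show ?case by (simp add: known_nodes_view_after)
next
  case (Suc k)
  have IH: "public_state c q (vw t v) k = residual V priv ZZ (q V) k"
    using Suc by auto
  show ?case
  proof (cases "residual V priv ZZ (q V) k")
    case (Ret x)
    then show ?thesis using IH by simp
  next
    case (Ask a b f)
    have h: "first_heard c (vw t v) k a = relayed V priv ZZ a v" if "2 + 2 * k \<le> t" "v \<in> V" for t v
      using public_state_first_heard[OF Suc.IH Ask] that by auto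
    have s: "send (compile c q) (vw (2 + 2 * k) u) v =
        encode (width c V) (b u (priv u) (relayed V priv ZZ a u))" if "u \<in> V" for u
      using Suc.IH[of u "2 + 2 * k"] that Ask h[of "2 + 2 * k" u]
      by (simp add: send_compile[OF refl] known_nodes_view_after own_private_def)
    have "second_heard c (vw t v) k a b = answer V priv ZZ a b"
      using Suc.prems s
      by (auto simp: h second_heard_def heard_def answer_def received_nth known_nodes_view_after
          own_private_def decode_encode fun_eq_iff)
    then show ?thesis using IH Ask by simp
  qed
qed

lemma compile_decides:
  assumes "v \<in> V"
  shows "decides_after (1 + 2 * steps_of V priv ZZ (q V)) (compile c q) V E L v
    (value_of V priv ZZ (q V) v)"
  unfolding decides_after_def
proof (intro conjI allI impI)
  show "result (compile c q) (vw (1 + 2 * steps_of V priv ZZ (q V)) v) =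
      Some (value_of V priv ZZ (q V) v)"
    using assms by (simp add: result_compile[OF refl] public_state_view_after residual_steps_of)
next
  fix s assume s: "s < 1 + 2 * steps_of V priv ZZ (q V)"
  show "result (compile c q) (vw s v) = None"
  proof (cases s)
    case (Suc t)
    \<comment> \<open>Fewer than two rounds per query have passed since the discovery round, so the
      reconstructed program is still a query and the node is undecided.\<close>
    then have "t div 2 < steps_of V priv ZZ (q V)" using s by linarith
    from residual_before[OF this] show ?thesis
      using assms Suc by (auto simp: result_compile[OF refl] public_state_view_after)
  qed (simp add: compile_def)
qed

lemma compile_bandwidth:
  assumes "finite V"
  shows "respects_bandwidth (2 * c) (compile c q) V E L"
  unfolding respects_bandwidth_def
proof (intro allI ballI impI)
  fix t u v assume uv: "u \<in> V" "v \<in> V" "u \<noteq> v"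
  then have n: "card V > 0" using assms card_gt_0_iff by blast
  have "real (floorlog 2 (card V)) \<le> log 2 (card V) + 1"
    using n by (simp add: floorlog_def)
  \<comment> \<open>Both summands are at most \<open>lg (card V)\<close>; this is the factor 2 in
    the bandwidth constant.\<close>
  also have "\<dots> \<le> 2 * lg (card V)" by (simp add: lg_def)
  finally have w: "real (width c V) \<le> real (2 * c) * lg (card V)"
    by (simp add: width_def mult_left_mono algebra_simps)
  have "length (send (compile c q) (vw t u) v) \<le> width c V"
  proof (cases t)
    case (Suc s)
    then show ?thesis using known_nodes_view_after[of u V t "compile c q" E L] uv
      by (auto simp: send_compile[OF refl] split: prog.split)
  qed (simp add: compile_def)
  then show "real (length (send (compile c q) (vw t u) v)) \<le> real (2 * c) * lg (card V)"
    using w by linarith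
qed

end

section \<open>Communication primitives\<close>

definition broadcast :: "(nat \<Rightarrow> local_input \<Rightarrow> nat) \<Rightarrow> (nat \<Rightarrow> nat) prog" where
  "broadcast f = Ask (\<lambda>_ _ _. 0) (\<lambda>w q _. f w q) Ret"

text \<open>\<open>V\<close>, \<open>A\<close> and \<open>k\<close> are public, so the choice yields
  the same map at every node; a suitable one exists when
  \<open>card A * k \<le> card V\<close>.\<close>

definition slot :: "nat set \<Rightarrow> nat set \<Rightarrow> nat \<Rightarrow> nat \<times> nat \<Rightarrow> nat" where
  "slot V A k = (SOME f. inj_on f (A \<times> {..<k}) \<and> f ` (A \<times> {..<k}) \<subseteq> V)"

text \<open>Every \<open>u \<in> A\<close> publishes \<open>k\<close> numbers; the node \<open>slot V A k (u, j)\<close> relays the \<open>j\<close>-th of them.\<close>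

definition gather :: "nat set \<Rightarrow> nat set \<Rightarrow> nat \<Rightarrow> (nat \<Rightarrow> local_input \<Rightarrow> nat \<Rightarrow> nat) \<Rightarrow> (nat \<Rightarrow> nat \<Rightarrow> nat) prog" where
  "gather V A k x = Ask
     (\<lambda>u q w. x u q (snd (inv_into (A \<times> {..<k}) (slot V A k) w)))
     (\<lambda>w q r. r (fst (inv_into (A \<times> {..<k}) (slot V A k) w)))
     (\<lambda>r. Ret (\<lambda>u j. r (slot V A k (u, j))))"

definition enum :: "nat set \<Rightarrow> nat \<Rightarrow> nat" where
  "enum V = (SOME f. bij_betw f {..<card V} V)"

text \<open>Method of conditional expectations: \<open>y\<close> consists of the digits that are already fixed.\<close>

primrec vote :: "nat set \<Rightarrow> (nat \<Rightarrow> local_input \<Rightarrow> nat \<Rightarrow> nat) \<Rightarrow> nat \<Rightarrow> nat \<Rightarrow> nat prog" where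
  "vote V cost 0 y = Ret y"
| "vote V cost (Suc l) y = Ask
     (\<lambda>u q w. \<Sum>s<card V ^ l.
        cost u q ((y * card V + inv_into {..<card V} (enum V) w) * card V ^ l + s))
     (\<lambda>w q r. \<Sum>u\<in>V. r u)
     (\<lambda>r. vote V cost l (y * card V + arg_min_on (\<lambda>i. r (enum V i)) {..<card V}))"

section \<open>Correctness of the communication primitives\<close>

lemma enum_bij: "finite V \<Longrightarrow> bij_betw (enum V) {..<card V} V"
  unfolding enum_def by (rule someI_ex[OF ex_bij_betw_nat_finite[folded lessThan_atLeast0]])

lemma slot_inj:
  assumes "finite V" "finite A" "card A * k \<le> card V"
  shows "inj_on (slot V A k) (A \<times> {..<k}) \<and> slot V A k ` (A \<times> {..<k}) \<subseteq> V"
proof -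
  have "\<exists>f. inj_on f (A \<times> {..<k}) \<and> f ` (A \<times> {..<k}) \<subseteq> V"
    using assms inj_on_iff_card_le[of "A \<times> {..<k}" V] by (simp add: card_cartesian_product)
  then show ?thesis unfolding slot_def by (rule someI_ex)
qed

text \<open>Groups the seeds that extend a prefix \<open>y\<close> by their next
  base-\<open>n\<close> digit; each \<open>i\<close> is one candidate in a vote.\<close>

lemma sum_digit_blocks:
  fixes f :: "nat \<Rightarrow> 'a::comm_monoid_add"
  shows "(\<Sum>s<n * k. f (y * (n * k) + s)) = (\<Sum>i<n. \<Sum>s<k. f ((y * n + i) * k + s))"
proof -
  have "(\<Sum>s<n * k. f (y * (n * k) + s)) = (\<Sum>i<n. \<Sum>s=i*k..<i*k+k. f (y * (n * k) + s))"
    by (rule sum.nat_group[symmetric])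
  also have "\<dots> = (\<Sum>i<n. \<Sum>s<k. f ((y * n + i) * k + s))"
  proof (rule sum.cong[OF refl])
    fix i
    have "(\<Sum>s=0+i*k..<k+i*k. f (y * (n * k) + s)) = (\<Sum>s=0..<k. f (y * (n * k) + (s + i * k)))"
      by (rule sum.shift_bounds_nat_ivl)
    then show "(\<Sum>s=i*k..<i*k+k. f (y * (n * k) + s)) = (\<Sum>s<k. f ((y * n + i) * k + s))"
      by (simp add: algebra_simps lessThan_atLeast0)
  qed
  finally show ?thesis .
qed

locale clique =
  fixes V :: "nat set" and P :: "nat \<Rightarrow> local_input" and Z :: nat
  assumes finite_V: "finite V" and V_nonempty: "V \<noteq> {}"
begin

abbreviation "n \<equiv> card V"
abbreviation "val \<equiv> value_of V P Z"
abbreviation "steps \<equiv> steps_of V P Z"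

lemma n_pos: "n > 0" using finite_V V_nonempty by (simp add: card_gt_0_iff)

lemma val_broadcast: "w \<in> V \<Longrightarrow> f w (P w) < Z \<Longrightarrow> val (broadcast f) w = f w (P w)"
  by (simp add: broadcast_def answer_def)

lemma steps_broadcast [simp]: "steps (broadcast f) = 1"
  by (simp add: broadcast_def)

lemma steps_gather [simp]: "steps (gather V A k x) = 1"
  by (simp add: gather_def)

lemma val_gather:
  assumes A: "A \<subseteq> V" "card A * k \<le> n" and u: "u \<in> A" "j < k" "x u (P u) j < Z"
  shows "val (gather V A k x) u j = x u (P u) j"
proof -
  have s: "inj_on (slot V A k) (A \<times> {..<k})" "slot V A k ` (A \<times> {..<k}) \<subseteq> V"
    using slot_inj[of V A k] A finite_V finite_subset by blast+
  have "inv_into (A \<times> {..<k}) (slot V A k) (slot V A k (u, j)) = (u, j)"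
    using s(1) u by (intro inv_into_f_f) auto
  moreover have "slot V A k (u, j) \<in> V" using s(2) u by auto
  ultimately show ?thesis
    using u A by (auto simp: gather_def answer_def relayed_def)
qed

lemma steps_vote [simp]: "steps (vote V cost l y) = l"
  by (induction l arbitrary: y) auto

text \<open>A digit of least block total never raises the average over the remaining extensions of
  the prefix, so the final seed costs at most the initial average. The bound by \<open>Z\<close>
  keeps both the sum sent by one node and the sum over \<open>V\<close> intact.\<close>

lemma val_vote:
  assumes "\<And>u s. u \<in> V \<Longrightarrow> cost u (P u) s \<le> K" and "n * n ^ l * K < Z"
  defines "tot \<equiv> \<lambda>s. \<Sum>u\<in>V. cost u (P u) s"
  shows "val (vote V cost l y) \<in> {y * n ^ l..<Suc y * n ^ l} \<and>
    tot (val (vote V cost l y)) * n ^ l \<le> (\<Sum>s<n ^ l. tot (y * n ^ l + s))"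
  using assms(2)
proof (induction l arbitrary: y)
  case (Suc l)
  let ?a = "\<lambda>u q w. \<Sum>s<n ^ l. cost u q ((y * n + inv_into {..<n} (enum V) w) * n ^ l + s)"
  let ?b = "\<lambda>w q r. \<Sum>u\<in>V. r u :: nat"
  let ?r = "answer V P Z ?a ?b"
  let ?T = "\<lambda>i. \<Sum>s<n ^ l. tot ((y * n + i) * n ^ l + s)"
  have less: "n * n ^ l * K < Z"
  proof -
    have "n * n ^ l * K \<le> n * n ^ Suc l * K"
      using n_pos by (intro mult_right_mono) auto
    then show ?thesis using Suc.prems by linarith
  qed
  have r: "?r (enum V i) = ?T i" if "i < n" for i
  proof -
    have inv: "inv_into {..<n} (enum V) (enum V i) = i"
      using enum_bij[OF finite_V] that by (meson bij_betw_inv_into_left lessThan_iff)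
    have V: "enum V i \<in> V"
      using enum_bij[OF finite_V] that by (auto simp: bij_betw_def)
    have one: "?a u (P u) (enum V i) \<le> n ^ l * K" if "u \<in> V" for u
      using sum_bounded_above[of "{..<n ^ l}" "\<lambda>s. cost u (P u)
          ((y * n + inv_into {..<n} (enum V) (enum V i)) * n ^ l + s)" K] assms(1)[OF that]
      by simp
    have "n ^ l * K \<le> n * n ^ l * K" using n_pos by simp
    then have "?a u (P u) (enum V i) < Z" if "u \<in> V" for u
      using one[OF that] less by linarith
    then have rel: "relayed V P Z ?a (enum V i) u = ?a u (P u) (enum V i)" if "u \<in> V" for u
      using that by (simp add: relayed_def)
    have "(\<Sum>u\<in>V. ?a u (P u) (enum V i)) \<le> n * (n ^ l * K)"
      using sum_bounded_above[of V "\<lambda>u. ?a u (P u) (enum V i)" "n ^ l * K"] one by simp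
    then have "(\<Sum>u\<in>V. ?a u (P u) (enum V i)) < Z" using less by (simp add: mult.assoc)
    then have "?r (enum V i) = (\<Sum>u\<in>V. ?a u (P u) (enum V i))"
      using V rel by (simp add: answer_def)
    also have "\<dots> = ?T i"
      unfolding inv tot_def by (rule sum.swap)
    finally show ?thesis .
  qed
  let ?i = "arg_min_on (\<lambda>i. ?r (enum V i)) {..<n}"
  have i: "?i < n" using arg_min_if_finite(1)[of "{..<n}" "\<lambda>i. ?r (enum V i)"] n_pos by force
  have min: "?T ?i \<le> ?T j" if "j < n" for j
    using arg_min_least[of "{..<n}" j "\<lambda>i. ?r (enum V i)"] that r[OF i] r[OF that] n_pos by force
  have v: "val (vote V cost (Suc l) y) = val (vote V cost l (y * n + ?i))" by simp
  let ?s = "val (vote V cost l (y * n + ?i))"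
  have IH: "?s \<in> {(y * n + ?i) * n ^ l..<Suc (y * n + ?i) * n ^ l}" "tot ?s * n ^ l \<le> ?T ?i"
    using Suc.IH[OF less, of "y * n + ?i"] by blast+
  have "{(y * n + i) * n ^ l..<Suc (y * n + i) * n ^ l} \<subseteq> {y * n ^ Suc l..<Suc y * n ^ Suc l}"
    if "i < n" for i
  proof -
    have "y * n ^ Suc l \<le> (y * n + i) * n ^ l" by (simp add: algebra_simps)
    moreover have "Suc (y * n + i) * n ^ l \<le> Suc y * n * n ^ l"
      using that by (intro mult_right_mono) auto
    ultimately show ?thesis by (simp add: algebra_simps)
  qed
  then have "?s \<in> {y * n ^ Suc l..<Suc y * n ^ Suc l}" using IH(1) i by blast
  moreover have "tot ?s * n ^ Suc l \<le> (\<Sum>s<n ^ Suc l. tot (y * n ^ Suc l + s))"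
  proof -
    have "tot ?s * n ^ Suc l = n * (tot ?s * n ^ l)" by simp
    also have "\<dots> \<le> n * ?T ?i" using IH(2) by (rule mult_left_mono) simp
    also have "\<dots> = (\<Sum>j<n. ?T ?i)" by simp
    also have "\<dots> \<le> (\<Sum>j<n. ?T j)" by (rule sum_mono) (use min in simp)
    also have "\<dots> = (\<Sum>s<n ^ Suc l. tot (y * n ^ Suc l + s))"
      using sum_digit_blocks[of tot y n "n ^ l"] by simp
    finally show ?thesis .
  qed
  ultimately show ?case unfolding v by blast
qed simp

end

section \<open>Nearly pairwise independent hashing\<close>

text \<open>On a residue class, \<open>j div g\<close> determines \<open>j\<close>, so it suffices
  to count quotients. The term \<open>2 * g\<close> covers the two ends of the interval.\<close>

lemma card_residue_class_le:
  fixes s t x g :: int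
  assumes "g > 0" "s \<le> t"
  shows "int (card {j \<in> {s..<t}. j mod g = x mod g}) * g \<le> t - s + 2 * g"
proof (cases "s = t")
  case False
  let ?S = "{j \<in> {s..<t}. j mod g = x mod g}"
  have "inj_on (\<lambda>j. j div g) ?S"
    by (rule inj_onI) (metis (mono_tags, lifting) div_mult_mod_eq mem_Collect_eq)
  moreover have "(\<lambda>j. j div g) ` ?S \<subseteq> {s div g..(t - 1) div g}"
    using assms(1) by (clarsimp simp: zdiv_mono1)
  ultimately have "card ?S \<le> card {s div g..(t - 1) div g}"
    by (intro card_inj_on_le) auto
  also have "\<dots> = nat ((t - 1) div g - s div g + 1)" by simp
  finally have "int (card ?S) \<le> (t - 1) div g - s div g + 1"
    using assms False zdiv_mono1[of s "t - 1" g] by linarith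
  then have "int (card ?S) * g \<le> ((t - 1) div g - s div g + 1) * g"
    using assms by (intro mult_right_mono) auto
  also have "\<dots> = (t - 1) div g * g - s div g * g + g"
    by (simp add: algebra_simps)
  also have "\<dots> \<le> t - s + 2 * g"
    using div_mult_mod_eq[of s g] div_mult_mod_eq[of "t - 1" g]
      pos_mod_bound[OF assms(1), of s] pos_mod_sign[OF assms(1), of "t - 1"] by linarith
  finally show ?thesis .
qed (use assms in auto)

text \<open>Two solutions differ by a multiple of \<open>M div gcd d M\<close>, so
  \<open>0..<M\<close> contains at most \<open>gcd d M\<close> of them.\<close>

lemma card_linear_congruence_le:
  fixes d x y M :: int
  assumes "M > 0" "d \<noteq> 0"
  shows "int (card {\<alpha> \<in> {0..<M}. (x + \<alpha> * d) mod M = y}) \<le> gcd d M"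
proof -
  let ?g = "gcd d M"
  define \<mu> where "\<mu> = M div ?g"
  have g: "?g > 0" using assms by (simp add: gcd_pos_int)
  have M: "\<mu> * ?g = M" unfolding \<mu>_def by simp
  have \<mu>: "\<mu> > 0" using M assms g by (metis zero_less_mult_pos2)
  let ?S = "{\<alpha> \<in> {0..<M}. (x + \<alpha> * d) mod M = y}"
  have *: "\<mu> dvd \<alpha> - \<beta>" if "\<alpha> \<in> ?S" "\<beta> \<in> ?S" for \<alpha> \<beta>
  proof -
    have "M dvd (x + \<alpha> * d) - (x + \<beta> * d)"
      unfolding mod_eq_dvd_iff[symmetric] using that by simp
    then have "M dvd (\<alpha> - \<beta>) * d" by (simp add: algebra_simps)
    then have "\<mu> * ?g dvd ((\<alpha> - \<beta>) * (d div ?g)) * ?g"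
      by (simp add: M mult.assoc)
    then have "\<mu> dvd (\<alpha> - \<beta>) * (d div ?g)" using assms by auto
    moreover have "coprime \<mu> (d div ?g)"
      unfolding \<mu>_def using div_gcd_coprime[of d M] assms by (simp add: coprime_commute)
    ultimately show ?thesis using coprime_dvd_mult_left_iff by blast
  qed
  have "inj_on (\<lambda>\<alpha>. \<alpha> div \<mu>) ?S"
  proof (rule inj_onI)
    fix \<alpha> \<beta> assume a: "\<alpha> \<in> ?S" "\<beta> \<in> ?S" "\<alpha> div \<mu> = \<beta> div \<mu>"
    have "\<alpha> mod \<mu> = \<beta> mod \<mu>" using *[OF a(1,2)] by (simp add: mod_eq_dvd_iff)
    then show "\<alpha> = \<beta>" using a(3) by (metis div_mult_mod_eq)
  qed
  moreover have "(\<lambda>\<alpha>. \<alpha> div \<mu>) ` ?S \<subseteq> {0..<?g}"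
  proof (clarsimp, intro conjI)
    fix \<alpha> assume "0 \<le> \<alpha>" "\<alpha> < M"
    then show "0 \<le> \<alpha> div \<mu>" using \<mu> by (simp add: pos_imp_zdiv_nonneg_iff)
    have "\<alpha> div \<mu> * \<mu> \<le> \<alpha>"
      using div_mult_mod_eq[of \<alpha> \<mu>] pos_mod_sign[OF \<mu>, of \<alpha>] by linarith
    also have "\<alpha> < ?g * \<mu>" using \<open>\<alpha> < M\<close> M by (simp add: mult.commute)
    finally show "\<alpha> div \<mu> < ?g" using \<mu> by (simp add: mult_less_cancel_right)
  qed
  ultimately have "card ?S \<le> card {0..<?g}"
    by (intro card_inj_on_le) auto
  then have "card ?S \<le> nat ?g" by simp
  then show ?thesis using g by linarith
qed

text \<open>Only values congruent to \<open>x\<close> modulo \<open>g = gcd d M\<close> are hit,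
  each at most \<open>g\<close> times. Their number is about \<open>(t - s) / g\<close>, so the two
  factors \<open>g\<close> cancel up to the boundary term, and
  \<open>g \<le> \<bar>d\<bar>\<close>.\<close>

lemma card_affine_hits_interval_le:
  fixes d x s t M :: int
  assumes "M > 0" "d \<noteq> 0" "s \<le> t"
  shows "int (card {\<alpha> \<in> {0..<M}. (x + \<alpha> * d) mod M \<in> {s..<t}}) \<le> t - s + 2 * \<bar>d\<bar>"
proof -
  let ?g = "gcd d M"
  have g: "?g > 0" using assms by (simp add: gcd_pos_int)
  let ?J = "{j \<in> {s..<t}. j mod ?g = x mod ?g}"
  let ?F = "\<lambda>j. {\<alpha> \<in> {0..<M}. (x + \<alpha> * d) mod M = j}"
  have "finite (?F j)" for j
    by (rule finite_subset[of _ "{0..<M}"]) auto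
  moreover have finJ: "finite ?J"
    by (rule finite_subset[of _ "{s..<t}"]) auto
  ultimately have fin: "finite (\<Union>j\<in>?J. ?F j)" by blast
  have "{\<alpha> \<in> {0..<M}. (x + \<alpha> * d) mod M \<in> {s..<t}} \<subseteq> (\<Union>j\<in>?J. ?F j)"
  proof
    fix \<alpha> assume a: "\<alpha> \<in> {\<alpha> \<in> {0..<M}. (x + \<alpha> * d) mod M \<in> {s..<t}}"
    have "(x + \<alpha> * d) mod M mod ?g = (x + \<alpha> * d) mod ?g"
      by (simp add: mod_mod_cancel)
    also have "\<dots> = x mod ?g"
      by (simp add: mod_eq_dvd_iff)
    finally show "\<alpha> \<in> (\<Union>j\<in>?J. ?F j)" using a by auto
  qed
  then have "card {\<alpha> \<in> {0..<M}. (x + \<alpha> * d) mod M \<in> {s..<t}} \<le> card (\<Union>j\<in>?J. ?F j)"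
    using fin by (intro card_mono) simp_all
  also have "\<dots> \<le> (\<Sum>j\<in>?J. card (?F j))"
    by (rule card_UN_le[OF finJ])
  finally have "int (card {\<alpha> \<in> {0..<M}. (x + \<alpha> * d) mod M \<in> {s..<t}}) \<le> (\<Sum>j\<in>?J. int (card (?F j)))"
    by (simp only: of_nat_le_iff flip: of_nat_sum)
  also have "\<dots> \<le> (\<Sum>j\<in>?J. ?g)"
    by (intro sum_mono card_linear_congruence_le assms)
  also have "\<dots> = int (card ?J) * ?g" by simp
  also have "\<dots> \<le> t - s + 2 * ?g" by (rule card_residue_class_le[OF g assms(3)])
  also have "\<dots> \<le> t - s + 2 * \<bar>d\<bar>"
    using gcd_le1_int[of "\<bar>d\<bar>" M] assms(2) by simp
  finally show ?thesis .
qed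

text \<open>The modulus need not be prime: the common divisor of \<open>M\<close> and \<open>u - v\<close> only causes an additive
  error of the size of the identifiers, which is negligible compared to the lengths of the
  intervals that are used.\<close>

definition hash :: "nat \<Rightarrow> nat \<Rightarrow> nat \<Rightarrow> nat" where
  "hash M s v = (s div M * v + s mod M) mod M"

lemma hash_less: "M > 0 \<Longrightarrow> hash M s v < M"
  by (simp add: hash_def)

text \<open>Change of variables from the seed to the hash \<open>X\<close> of \<open>v\<close> and
  the slope \<alpha>. Then the hash of \<open>u\<close> is \<open>X + \<alpha> * (u - v)\<close>
  modulo \<open>M\<close>, and for each of the \<open>card I\<close> values of \<open>X\<close> the
  previous lemma counts the slopes.\<close>

lemma card_hash_pair_le:
  fixes D :: nat
  assumes M: "M > 0" and uv: "u \<noteq> v" "u \<le> D" "v \<le> D" and I: "I \<subseteq> {..<M}" and J: "x \<le> y"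
  shows "card {s \<in> {..<M * M}. hash M s v \<in> I \<and> hash M s u \<in> {x..<y}} \<le> card I * (y - x + 2 * D)"
proof -
  let ?S = "{s \<in> {..<M * M}. hash M s v \<in> I \<and> hash M s u \<in> {x..<y}}"
  let ?d = "int u - int v"
  let ?F = "\<lambda>X. {\<alpha> \<in> {0..<int M}. (int X + \<alpha> * ?d) mod int M \<in> {int x..<int y}}"
  let ?f = "\<lambda>s. (hash M s v, int (s div M))"
  have fin: "finite I" using I finite_subset by blast
  have "\<bar>?d\<bar> \<le> int D" using uv by linarith
  have finF: "finite (?F X)" for X
    by (rule finite_subset[of _ "{0..<int M}"]) auto
  have "inj_on ?f ?S"
  proof (rule inj_onI)
    fix s t assume s: "s \<in> ?S" "t \<in> ?S" "?f s = ?f t"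
    then have d: "s div M = t div M" by simp
    have "int ((s div M * v + s mod M) mod M) = int ((s div M * v + t mod M) mod M)"
      using s d by (simp add: hash_def)
    then have "(int (s div M * v) + int (s mod M)) mod int M = (int (s div M * v) + int (t mod M)) mod int M"
      by (simp only: zmod_int of_nat_add)
    then have "int M dvd int (s mod M) - int (t mod M)" by (simp add: mod_eq_dvd_iff)
    moreover have "\<bar>int (s mod M) - int (t mod M)\<bar> < int M"
      using mod_less_divisor[OF M, of s] mod_less_divisor[OF M, of t] by linarith
    ultimately have "s mod M = t mod M"
      using zdvd_not_zless[of "\<bar>int (s mod M) - int (t mod M)\<bar>" "int M"] by force
    then show "s = t" using d by (metis div_mult_mod_eq)
  qed
  moreover have "?f ` ?S \<subseteq> Sigma I ?F"
  proof
    fix z assume "z \<in> ?f ` ?S"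
    then obtain s where s: "s \<in> ?S" "z = ?f s" by blast
    have "(int (hash M s v) + int (s div M) * ?d) mod int M = int (hash M s u)"
    proof -
      have "(int (hash M s v) + int (s div M) * ?d) mod int M =
        (int (s div M) * int v + int (s mod M) + int (s div M) * ?d) mod int M"
        by (simp add: hash_def zmod_int mod_add_left_eq)
      also have "int (s div M) * int v + int (s mod M) + int (s div M) * ?d =
          int (s div M) * int u + int (s mod M)" by (simp add: algebra_simps)
      finally show ?thesis by (simp add: hash_def zmod_int)
    qed
    moreover have "s div M < M" using s M by (simp add: less_mult_imp_div_less)
    ultimately show "z \<in> Sigma I ?F" using s by auto
  qed
  ultimately have "card ?S \<le> card (Sigma I ?F)"
    using finite_SigmaI[OF fin finF] by (intro card_inj_on_le)
  also have "\<dots> = (\<Sum>X\<in>I. card (?F X))" using fin finF by (intro card_SigmaI) blast+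
  also have "\<dots> \<le> (\<Sum>X\<in>I. y - x + 2 * D)"
  proof (rule sum_mono)
    fix X
    have "int (card (?F X)) \<le> int y - int x + 2 * \<bar>?d\<bar>"
      using M uv J by (intro card_affine_hits_interval_le) auto
    also have "\<dots> \<le> int (y - x + 2 * D)"
      using \<open>\<bar>?d\<bar> \<le> int D\<close> J by (simp add: of_nat_diff)
    finally show "card (?F X) \<le> y - x + 2 * D" by (simp only: of_nat_le_iff)
  qed
  finally show ?thesis by simp
qed

section \<open>Choosing the next color digit\<close>

lemma real_divide_le_div_add_1: "real a / real b \<le> real (a div b) + 1"
proof (cases "b = 0")
  case False
  then have "real (a mod b) / real b \<le> 1" by (simp add: divide_le_eq_1 less_imp_le)
  then show ?thesis using of_nat_of_nat_div_aux[of a b, where 'a = real] by linarith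
qed simp

text \<open>If \<open>T 0, ..., T B\<close> delimit the intervals of the digits, \<open>t i\<close>
  is \<open>T (Suc i)\<close>. Only the \<open>B - 1\<close> inner thresholds are consulted, and the
  digit \<open>B - 1\<close> is the default.\<close>

definition pick :: "nat \<Rightarrow> (nat \<Rightarrow> nat) \<Rightarrow> nat \<Rightarrow> nat" where
  "pick B t h = (LEAST i. i = B - 1 \<or> h < t i)"

lemma pick_interval:
  assumes "0 < B" "T 0 = 0" "h < T B" "\<And>i. i < B - 1 \<Longrightarrow> t i = T (Suc i)"
  shows "pick B t h < B \<and> T (pick B t h) \<le> h \<and> h < T (Suc (pick B t h))"
proof -
  let ?Q = "\<lambda>i. i = B - 1 \<or> h < t i"
  have 1: "?Q (pick B t h)" unfolding pick_def by (rule LeastI[of ?Q "B - 1"]) simp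
  have 2: "pick B t h \<le> B - 1" unfolding pick_def by (rule Least_le) simp
  have 3: "T (pick B t h) \<le> h"
  proof (cases "pick B t h")
    case (Suc i)
    then have "\<not> ?Q i" unfolding pick_def by (intro not_less_Least) simp
    then show ?thesis using Suc 2 assms(4)[of i] by auto
  qed (use assms in simp)
  have "h < T (Suc (pick B t h))"
    using 1 2 assms by (cases "pick B t h = B - 1") auto
  then show ?thesis using 2 3 assms(1) by linarith
qed

text \<open>For \<open>b\<close> a power of the base, \<open>y\<close> is a prefix of digits and the
  block consists of the colors in \<open>S\<close> that extend it.\<close>

definition block :: "nat set \<Rightarrow> nat \<Rightarrow> nat \<Rightarrow> nat set" where
  "block S b y = {c \<in> S. c div b = y}"

definition cumulative :: "nat set \<Rightarrow> nat \<Rightarrow> nat \<Rightarrow> nat \<Rightarrow> nat" where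
  "cumulative S b y j = card {c \<in> S. y \<le> c div b \<and> c div b < y + j}"

text \<open>The \<open>B - 1\<close> inner thresholds split \<open>{..<M}\<close> into intervals of lengths proportional to the
  numbers of colors with each possible next digit. A node publishes them, so everyone can compute
  its choice for every seed.\<close>

definition threshold :: "nat \<Rightarrow> nat set \<Rightarrow> nat \<Rightarrow> nat \<Rightarrow> nat \<Rightarrow> nat \<Rightarrow> nat" where
  "threshold M S b B y j = cumulative S b (y * B) j * M div cumulative S b (y * B) B"

lemma cumulative_0 [simp]: "cumulative S b y 0 = 0"
proof -
  have "{c \<in> S. y \<le> c div b \<and> c div b < y + 0} = {}" by auto
  then show ?thesis by (simp only: cumulative_def card.empty)
qed

lemma cumulative_Suc:
  assumes "finite S"
  shows "cumulative S b y (Suc j) = cumulative S b y j + card (block S b (y + j))"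
proof -
  have "{c \<in> S. y \<le> c div b \<and> c div b < y + Suc j} =
      {c \<in> S. y \<le> c div b \<and> c div b < y + j} \<union> block S b (y + j)"
    by (auto simp: block_def)
  moreover have "{c \<in> S. y \<le> c div b \<and> c div b < y + j} \<inter> block S b (y + j) = {}"
    by (auto simp: block_def)
  ultimately show ?thesis
    unfolding cumulative_def using assms by (simp add: card_Un_disjoint block_def)
qed

lemma cumulative_sum:
  "finite S \<Longrightarrow> cumulative S b y j = (\<Sum>i<j. card (block S b (y + i)))"
  by (induction j) (auto simp: cumulative_Suc)

lemma cumulative_base:
  assumes "B > 0"
  shows "cumulative S b (y * B) B = card (block S (b * B) y)"
proof -
  have "y * B \<le> x \<and> x < y * B + B \<longleftrightarrow> x div B = y" for x
    using assms div_nat_eqI[of B y x] dividend_less_div_times[of B x] div_times_less_eq_dividend[of x B]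
    by (auto simp: algebra_simps)
  then show ?thesis by (simp add: cumulative_def block_def div_mult2_eq)
qed

lemma threshold_0 [simp]: "threshold M S b B y 0 = 0"
  by (simp add: threshold_def)

lemma threshold_base:
  "B > 0 \<Longrightarrow> card (block S (b * B) y) > 0 \<Longrightarrow> threshold M S b B y B = M"
  by (simp add: threshold_def cumulative_base)

text \<open>Rounding changes an interval length by at most 1, and an interval for
  \<open>k = 0\<close> colors is empty. Hence the error can be charged as \<open>k\<close> instead
  of 1, which keeps the bound proportional to \<open>k\<close>.\<close>

lemma threshold_Suc:
  fixes i :: nat
  assumes "finite S" "B > 0" and K: "card (block S (b * B) y) > 0"
  defines "k \<equiv> card (block S b (y * B + i))" and "K \<equiv> card (block S (b * B) y)"
  shows "threshold M S b B y i \<le> threshold M S b B y (Suc i)"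
    and "real (threshold M S b B y (Suc i) - threshold M S b B y i) \<le> real k * (real M / real K + 1)"
proof -
  let ?c = "cumulative S b (y * B) i"
  have T: "threshold M S b B y j = cumulative S b (y * B) j * M div K" for j
    using assms(2) by (simp add: threshold_def cumulative_base K_def)
  have c: "cumulative S b (y * B) (Suc i) = ?c + k"
    using assms(1) by (simp add: cumulative_Suc k_def)
  show *: "threshold M S b B y i \<le> threshold M S b B y (Suc i)"
    unfolding T c by (intro div_le_mono) (simp add: algebra_simps)
  show "real (threshold M S b B y (Suc i) - threshold M S b B y i) \<le> k * (M / K + 1)"
  proof (cases "k = 0")
    case False
    have K0: "real K > 0" using K by (simp add: K_def)
    have "real (threshold M S b B y (Suc i)) \<le> real ((?c + k) * M) / K"
      unfolding T c by (rule of_nat_div_le_of_nat)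
    moreover have "real (?c * M) / K \<le> threshold M S b B y i + 1"
      unfolding T using real_divide_le_div_add_1[of "?c * M" K] by simp
    ultimately have "real (threshold M S b B y (Suc i) - threshold M S b B y i) \<le>
        real ((?c + k) * M) / K - real (?c * M) / K + 1"
      using * by (simp add: of_nat_diff)
    also have "\<dots> = k * (M / K) + 1" using K0 by (simp add: field_simps)
    also have "\<dots> \<le> k * (M / K + 1)" using False by (simp add: algebra_simps)
    finally show ?thesis .
  qed (simp add: T c)
qed

text \<open>The right-hand side is \<open>M\<^sup>2 / K v\<close> up to lower-order terms: with exactly pairwise
  independent choices made in proportion to the list sizes, the expectation of the left-hand
  side would be \<open>1 / K v\<close>.\<close>

lemma expected_collision_cost:
  fixes kv ku Tv Tu :: "nat \<Rightarrow> nat" and Kv Ku :: nat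
  assumes M: "M > 0" and uv: "u \<noteq> v" "u \<le> D" "v \<le> D"
    and Tv: "\<And>i. i < B \<Longrightarrow> Tv i \<le> Tv (Suc i)" "Tv B = M"
      "\<And>i. i < B \<Longrightarrow> real (Tv (Suc i) - Tv i) \<le> kv i * (M / Kv + 1)"
    and Tu: "\<And>i. i < B \<Longrightarrow> Tu i \<le> Tu (Suc i)"
      "\<And>i. i < B \<Longrightarrow> real (Tu (Suc i) - Tu i) \<le> ku i * (M / Ku + 1)"
    and Ku: "Ku = (\<Sum>i<B. ku i)" "Ku > 0"
    and pv: "\<And>s. s < M * M \<Longrightarrow> pv s < B \<and> Tv (pv s) \<le> hash M s v \<and> hash M s v < Tv (Suc (pv s))"
    and pu: "\<And>s. s < M * M \<Longrightarrow> pu s < B \<and> Tu (pu s) \<le> hash M s u \<and> hash M s u < Tu (Suc (pu s))"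
  shows "(\<Sum>s<M * M. if pu s = pv s then 1 / real (kv (pv s)) else 0) \<le>
    (M / Kv + 1) * real (M + Ku * (1 + 2 * D))"
proof -
  let ?S = "\<lambda>i. {s \<in> {..<M * M}. pv s = i \<and> pu s = i}"
  have TvM: "Tv (Suc i) \<le> M" if "i < B" for i
  proof -
    have "Tv (Suc i) \<le> Tv B"
      by (rule dec_induct[of "Suc i" B "\<lambda>j. Tv (Suc i) \<le> Tv j"])
         (use that Tv(1) in \<open>auto intro: order_trans\<close>)
    then show ?thesis using Tv(2) by simp
  qed
  \<comment> \<open>The weight \<open>1 / kv i\<close> cancels the factor \<open>kv i\<close> in the
    interval length of \<open>v\<close>; what remains is proportional to \<open>ku i\<close> and
    sums to \<open>Ku\<close>.\<close>
  have card_S: "real (card (?S i)) / kv i \<le> (M / Kv + 1) * (ku i * (M / Ku + 1 + 2 * D))"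
    if i: "i < B" for i
  proof (cases "ku i = 0 \<or> kv i = 0")
    case True
    then show ?thesis
    proof
      assume "ku i = 0"
      then have "Tu (Suc i) = Tu i" using Tu(1,2)[OF i] by simp
      then have "?S i = {}" using pu by fastforce
      then show ?thesis using \<open>ku i = 0\<close> by (simp only: card.empty)
    qed simp
  next
    case False
    have "card (?S i) \<le> card {s \<in> {..<M * M}. hash M s v \<in> {Tv i..<Tv (Suc i)} \<and> hash M s u \<in> {Tu i..<Tu (Suc i)}}"
    proof (intro card_mono subsetI)
      fix s assume "s \<in> ?S i"
      then show "s \<in> {s \<in> {..<M * M}. hash M s v \<in> {Tv i..<Tv (Suc i)} \<and> hash M s u \<in> {Tu i..<Tu (Suc i)}}"
        using pv[of s] pu[of s] by auto
    qed simp
    also have "\<dots> \<le> card {Tv i..<Tv (Suc i)} * (Tu (Suc i) - Tu i + 2 * D)"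
      using M uv TvM[OF i] Tu(1)[OF i] by (intro card_hash_pair_le) auto
    finally have "card (?S i) \<le> (Tv (Suc i) - Tv i) * (Tu (Suc i) - Tu i + 2 * D)" by simp
    then have "real (card (?S i)) \<le> real ((Tv (Suc i) - Tv i) * (Tu (Suc i) - Tu i + 2 * D))"
      by (rule of_nat_mono)
    also have "\<dots> = real (Tv (Suc i) - Tv i) * (real (Tu (Suc i) - Tu i) + real (2 * D))"
      by (simp only: of_nat_mult of_nat_add)
    also have "\<dots> \<le> (kv i * (M / Kv + 1)) * (ku i * (M / Ku + 1) + ku i * real (2 * D))"
    proof (intro mult_mono add_mono Tv(3)[OF i] Tu(2)[OF i])
      \<comment> \<open>Here \<open>ku i\<close> is at least 1, so the hashing error
        \<open>2 * D\<close> may be multiplied by it as well.\<close>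
      have "1 * real (2 * D) \<le> real (ku i) * real (2 * D)"
        using False by (intro mult_right_mono) auto
      then show "real (2 * D) \<le> real (ku i) * real (2 * D)" by simp
    qed auto
    also have "\<dots> = kv i * ((M / Kv + 1) * (ku i * (M / Ku + 1 + real (2 * D))))"
      by (simp only: distrib_left[of "real (ku i)"] mult.assoc)
    finally have "real (card (?S i)) \<le> kv i * ((M / Kv + 1) * (ku i * (M / Ku + 1 + 2 * D)))"
      by simp
    then show ?thesis using False by (simp add: divide_le_eq mult.commute)
  qed
  have "(\<Sum>s<M * M. if pu s = pv s then 1 / real (kv (pv s)) else 0) =
      (\<Sum>s<M * M. \<Sum>i<B. if pv s = i \<and> pu s = i then 1 / real (kv i) else 0)"
  proof (rule sum.cong[OF refl])
    fix s assume "s \<in> {..<M * M}"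
    then have "pv s < B" using pv by simp
    then have "(\<Sum>i<B. if pv s = i \<and> pu s = i then 1 / real (kv i) else 0) =
        (\<Sum>i<B. if pv s = i then (if pu s = i then 1 / real (kv i) else 0) else 0)"
      by (intro sum.cong) auto
    also have "\<dots> = (if pu s = pv s then 1 / real (kv (pv s)) else 0)"
      using \<open>pv s < B\<close> by (simp add: sum.delta')
    finally show "(if pu s = pv s then 1 / real (kv (pv s)) else 0) =
      (\<Sum>i<B. if pv s = i \<and> pu s = i then 1 / real (kv i) else 0)" by simp
  qed
  also have "\<dots> = (\<Sum>i<B. \<Sum>s<M * M. if pv s = i \<and> pu s = i then 1 / real (kv i) else 0)"
    by (rule sum.swap)
  also have "\<dots> = (\<Sum>i<B. real (card (?S i)) / kv i)"
    by (intro sum.cong refl) (simp add: sum.If_cases Int_def)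
  also have "\<dots> \<le> (\<Sum>i<B. (M / Kv + 1) * (ku i * (M / Ku + 1 + 2 * D)))"
    using card_S by (intro sum_mono) auto
  also have "\<dots> = (M / Kv + 1) * (Ku * (M / Ku + 1 + 2 * D))"
    unfolding Ku(1) by (simp add: sum_distrib_left sum_distrib_right)
  also have "Ku * (M / Ku + 1 + 2 * D) = real (M + Ku * (1 + 2 * D))"
    using Ku(2) by (simp add: field_simps)
  finally show ?thesis .
qed

section \<open>The potential function\<close>

definition conflicts :: "(nat \<Rightarrow> nat set) \<Rightarrow> nat set \<Rightarrow> (nat \<Rightarrow> nat) \<Rightarrow> nat \<Rightarrow> nat set" where
  "conflicts N A p v = {u \<in> N v \<inter> A. p u = p v}"

text \<open>For \<open>b = 1\<close> and colors \<open>p v \<in> S v\<close> all denominators are 1,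
  so with symmetric neighborhoods every monochromatic edge inside \<open>A\<close> counts
  twice.\<close>

definition potential :: "(nat \<Rightarrow> nat set) \<Rightarrow> nat set \<Rightarrow> (nat \<Rightarrow> nat set) \<Rightarrow> nat \<Rightarrow> (nat \<Rightarrow> nat) \<Rightarrow> real" where
  "potential N A S b p = (\<Sum>v\<in>A. card (conflicts N A p v) / card (block (S v) b (p v)))"

definition refined :: "nat \<Rightarrow> nat \<Rightarrow> (nat \<Rightarrow> nat \<Rightarrow> nat) \<Rightarrow> (nat \<Rightarrow> nat) \<Rightarrow> nat \<Rightarrow> nat \<Rightarrow> nat" where
  "refined M B t p s u = p u * B + pick B (t u) (hash M s u)"

context
  fixes N :: "nat \<Rightarrow> nat set" and A :: "nat set" and S :: "nat \<Rightarrow> nat set" and p :: "nat \<Rightarrow> nat"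
    and t :: "nat \<Rightarrow> nat \<Rightarrow> nat" and M B b :: nat
  assumes finite_A: "finite A"
    and finite_S: "\<And>v. v \<in> A \<Longrightarrow> finite (S v)"
    and nonempty: "\<And>v. v \<in> A \<Longrightarrow> block (S v) (b * B) (p v) \<noteq> {}"
    and t: "\<And>u j. u \<in> A \<Longrightarrow> j < B - 1 \<Longrightarrow> t u j = threshold M (S u) b B (p u) (Suc j)"
    and pos: "M > 0" "B > 0"
begin

lemma card_block_pos: "v \<in> A \<Longrightarrow> card (block (S v) (b * B) (p v)) > 0"
  using nonempty finite_S by (auto simp: card_gt_0_iff block_def)

lemma pick_threshold:
  assumes "v \<in> A"
  shows "pick B (t v) (hash M s v) < B \<and>
    threshold M (S v) b B (p v) (pick B (t v) (hash M s v)) \<le> hash M s v \<and>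
    hash M s v < threshold M (S v) b B (p v) (Suc (pick B (t v) (hash M s v)))"
  using pos card_block_pos[OF assms] t[OF assms]
  by (intro pick_interval) (auto simp: threshold_base hash_less)

text \<open>The interval of a digit without colors is empty and cannot contain the hash
  value.\<close>

lemma refined_nonempty:
  assumes "v \<in> A"
  shows "block (S v) b (refined M B t p s v) \<noteq> {}"
proof
  assume "block (S v) b (refined M B t p s v) = {}"
  then have "threshold M (S v) b B (p v) (Suc (pick B (t v) (hash M s v))) =
      threshold M (S v) b B (p v) (pick B (t v) (hash M s v))"
    using finite_S[OF assms] by (simp add: threshold_def cumulative_Suc refined_def)
  then show False using pick_threshold[OF assms, of s] by simp
qed

lemma refined_eq_iff:
  assumes "u \<in> A" "v \<in> A"
  shows "refined M B t p s u = refined M B t p s v \<longleftrightarrow>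
    p u = p v \<and> pick B (t u) (hash M s u) = pick B (t v) (hash M s v)"
proof
  assume eq: "refined M B t p s u = refined M B t p s v"
  have "refined M B t p s w div B = p w" if "w \<in> A" for w
    using pick_threshold[OF that, of s] by (simp add: refined_def)
  then have "p u = p v" using assms eq by metis
  then show "p u = p v \<and> pick B (t u) (hash M s u) = pick B (t v) (hash M s v)"
    using eq by (simp add: refined_def)
qed (simp add: refined_def)

lemma expected_collision_block:
  fixes \<epsilon> :: real
  assumes uv: "u \<in> A" "v \<in> A" "u \<noteq> v" "p u = p v" "u \<le> D" "v \<le> D"
    and K: "card (S u) \<le> K" "card (S v) \<le> K" and \<epsilon>: "3 * real (K * (1 + 2 * D)) \<le> \<epsilon> * M" "\<epsilon> \<le> 1"
  shows "(\<Sum>s<M * M. if refined M B t p s u = refined M B t p s v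
      then 1 / real (card (block (S v) b (refined M B t p s v))) else 0) \<le>
    M * M * (1 + \<epsilon>) / card (block (S v) (b * B) (p v))"
proof -
  let ?Kv = "card (block (S v) (b * B) (p v))" and ?Ku = "card (block (S u) (b * B) (p u))"
  let ?k = "\<lambda>w i. card (block (S w) b (p w * B + i))"
  have "?Kv \<le> card (S v)" "?Ku \<le> card (S u)"
    using uv finite_S by (auto intro!: card_mono simp: block_def)
  then have Kle: "?Kv \<le> K" "?Ku \<le> K" using K by linarith+
  have Kpos: "?Kv > 0" "?Ku > 0" using card_block_pos[OF uv(2)] card_block_pos[OF uv(1)] by auto
  have "(\<Sum>s<M * M. if refined M B t p s u = refined M B t p s v
      then 1 / real (card (block (S v) b (refined M B t p s v))) else 0) =
    (\<Sum>s<M * M. if pick B (t u) (hash M s u) = pick B (t v) (hash M s v)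
      then 1 / real (?k v (pick B (t v) (hash M s v))) else 0)"
    using uv by (intro sum.cong) (auto simp: refined_eq_iff, simp add: refined_def)
  also have "\<dots> \<le> (M / ?Kv + 1) * real (M + ?Ku * (1 + 2 * D))"
  proof (rule expected_collision_cost[where Tv = "threshold M (S v) b B (p v)"
        and Tu = "threshold M (S u) b B (p u)" and kv = "?k v" and ku = "?k u" and B = B
        and pv = "\<lambda>s. pick B (t v) (hash M s v)" and pu = "\<lambda>s. pick B (t u) (hash M s u)"])
    show "?Ku = (\<Sum>i<B. ?k u i)"
      using cumulative_base[OF pos(2), of "S u" b "p u"] cumulative_sum[OF finite_S[OF uv(1)]] by metis
    show "threshold M (S v) b B (p v) B = M" using threshold_base[OF pos(2) Kpos(1)] .
  qed (rule pos uv Kpos pick_threshold[OF uv(1)] pick_threshold[OF uv(2)]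
      threshold_Suc[OF finite_S[OF uv(1)] pos(2) Kpos(2)]
      threshold_Suc[OF finite_S[OF uv(2)] pos(2) Kpos(1)])+
  also have "\<dots> = (M * M / ?Kv) * ((1 + ?Kv / M) * (1 + ?Ku * (1 + 2 * D) / M))"
    using pos Kpos by (simp add: field_simps)
  also have "\<dots> \<le> (M * M / ?Kv) * (1 + \<epsilon>)"
  proof (intro mult_left_mono)
    \<comment> \<open>\<delta> bounds both relative errors: the rounding for \<open>v\<close>, and
      the rounding plus hashing error for \<open>u\<close>. As \<delta> is at most 1, the product of
      the two factors is at most 1 + 3 \<delta>, which explains the 3 in the hypothesis.\<close>
    define \<delta> where "\<delta> = real (K * (1 + 2 * D)) / M"
    have "?Kv / M \<le> \<delta>"
    proof -
      have "?Kv * 1 \<le> K * (1 + 2 * D)" using Kle by (intro mult_le_mono) auto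
      then show ?thesis unfolding \<delta>_def by (intro divide_right_mono) (simp_all only: of_nat_le_iff mult_1_right of_nat_0_le_iff)
    qed
    moreover have "?Ku * (1 + 2 * D) / M \<le> \<delta>"
    proof -
      have "?Ku * (1 + 2 * D) \<le> K * (1 + 2 * D)" using Kle by (intro mult_le_mono) auto
      then show ?thesis unfolding \<delta>_def by (intro divide_right_mono) (simp_all only: of_nat_le_iff of_nat_0_le_iff)
    qed
    ultimately have "(1 + ?Kv / M) * (1 + ?Ku * (1 + 2 * D) / M) \<le> (1 + \<delta>) * (1 + \<delta>)"
      by (intro mult_mono add_mono order_refl) (auto simp: \<delta>_def)
    also have "\<dots> \<le> 1 + 3 * \<delta>"
    proof -
      have "3 * \<delta> \<le> \<epsilon>" using \<epsilon>(1) pos by (simp add: \<delta>_def field_simps)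
      moreover have "0 \<le> \<delta>" by (simp add: \<delta>_def)
      ultimately have "\<delta> \<le> 1" "0 \<le> \<delta>" using \<epsilon>(2) by linarith+
      then have "\<delta> * \<delta> \<le> \<delta>" using mult_right_mono[of \<delta> 1 \<delta>] by simp
      then show ?thesis by (simp add: algebra_simps)
    qed
    also have "\<dots> \<le> 1 + \<epsilon>" using \<epsilon>(1) pos by (simp add: \<delta>_def field_simps)
    finally show "(1 + ?Kv / M) * (1 + ?Ku * (1 + 2 * D) / M) \<le> 1 + \<epsilon>" .
  qed auto
  finally show ?thesis by simp
qed

text \<open>Linearity over ordered pairs: only pairs with equal prefixes can still agree after one
  more digit, and each of them contributes at most \<open>1 + \<epsilon>\<close> times its old share
  on average over the \<open>M * M\<close> seeds.\<close>

lemma expected_potential: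
  fixes \<epsilon> :: real
  assumes N: "\<And>v. v \<in> A \<Longrightarrow> v \<notin> N v" and D: "\<And>v. v \<in> A \<Longrightarrow> v \<le> D"
    and K: "\<And>v. v \<in> A \<Longrightarrow> card (S v) \<le> K"
    and \<epsilon>: "3 * real (K * (1 + 2 * D)) \<le> \<epsilon> * M" "\<epsilon> \<le> 1"
  shows "(\<Sum>s<M * M. potential N A S b (refined M B t p s)) \<le>
    M * M * (1 + \<epsilon>) * potential N A S (b * B) p"
proof -
  let ?w = "\<lambda>s u v. if refined M B t p s u = refined M B t p s v
      then 1 / real (card (block (S v) b (refined M B t p s v))) else 0"
  have "(\<Sum>s<M * M. potential N A S b (refined M B t p s)) =
      (\<Sum>v\<in>A. \<Sum>s<M * M. card (conflicts N A (refined M B t p s) v) /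
        card (block (S v) b (refined M B t p s v)))"
    unfolding potential_def by (rule sum.swap)
  also have "\<dots> \<le> (\<Sum>v\<in>A. M * M * (1 + \<epsilon>) * (card (conflicts N A p v) / card (block (S v) (b * B) (p v))))"
  proof (rule sum_mono)
    fix v assume v: "v \<in> A"
    have fin: "finite (conflicts N A p v)"
      using finite_A by (simp add: conflicts_def)
    have "(\<Sum>s<M * M. card (conflicts N A (refined M B t p s) v) /
        card (block (S v) b (refined M B t p s v))) = (\<Sum>s<M * M. \<Sum>u\<in>conflicts N A p v. ?w s u v)"
    proof (rule sum.cong[OF refl])
      fix s
      have "conflicts N A (refined M B t p s) v =
          {u \<in> conflicts N A p v. refined M B t p s u = refined M B t p s v}"
        using v by (auto simp: conflicts_def refined_eq_iff)
      then show "card (conflicts N A (refined M B t p s) v) / card (block (S v) b (refined M B t p s v))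
          = (\<Sum>u\<in>conflicts N A p v. ?w s u v)"
        using fin by (simp add: sum.If_cases Int_def)
    qed
    also have "\<dots> = (\<Sum>u\<in>conflicts N A p v. \<Sum>s<M * M. ?w s u v)" by (rule sum.swap)
    also have "\<dots> \<le> (\<Sum>u\<in>conflicts N A p v. M * M * (1 + \<epsilon>) / card (block (S v) (b * B) (p v)))"
    proof (rule sum_mono)
      fix u assume u: "u \<in> conflicts N A p v"
      then have "u \<noteq> v" using N[OF v] by (auto simp: conflicts_def)
      with u v show "(\<Sum>s<M * M. ?w s u v) \<le> M * M * (1 + \<epsilon>) / card (block (S v) (b * B) (p v))"
        by (intro expected_collision_block[OF _ v _ _ D D K K \<epsilon>]) (auto simp: conflicts_def)
    qed
    finally show "(\<Sum>s<M * M. card (conflicts N A (refined M B t p s) v) /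
        card (block (S v) b (refined M B t p s v))) \<le>
      M * M * (1 + \<epsilon>) * (card (conflicts N A p v) / card (block (S v) (b * B) (p v)))"
      by (simp add: mult.commute)
  qed
  also have "\<dots> = M * M * (1 + \<epsilon>) * potential N A S (b * B) p"
    by (simp add: potential_def sum_distrib_left)
  finally show ?thesis .
qed

end

text \<open>Nodes vote with integers, so they scale their cost by \<open>Q\<close> and round it down.\<close>

definition scaled_cost where
  "scaled_cost Q N A S b p v = Q * card (conflicts N A p v) div card (block (S v) b (p v))"

text \<open>Rounding down only lowers the average, and at the selected seed it hides at most 1 per
  active node, that is \<open>card A / Q\<close> after undoing the scaling.\<close>

lemma potential_of_scaled_cost:
  assumes "finite A" "Q > 0" "m > 0"
    and min: "(\<Sum>v\<in>A. scaled_cost Q N A S b (p s) v) * m \<le>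
      (\<Sum>s'<m. \<Sum>v\<in>A. scaled_cost Q N A S b (p s') v)"
    and avg: "(\<Sum>s'<m. potential N A S b (p s')) \<le> real m * x"
  shows "potential N A S b (p s) \<le> x + card A / Q"
proof -
  let ?c = "\<lambda>s v. real (scaled_cost Q N A S b (p s) v)"
  let ?e = "\<lambda>s v. real (Q * card (conflicts N A (p s) v)) / card (block (S v) b (p s v))"
  have e: "(\<Sum>v\<in>A. ?e s v) = Q * potential N A S b (p s)" for s
    by (simp add: potential_def sum_distrib_left)
  have "real m * (\<Sum>v\<in>A. ?c s v) \<le> (\<Sum>s'<m. \<Sum>v\<in>A. ?c s' v)"
    using min by (simp flip: of_nat_sum of_nat_mult add: mult.commute)
  also have "\<dots> \<le> (\<Sum>s'<m. \<Sum>v\<in>A. ?e s' v)"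
    unfolding scaled_cost_def by (intro sum_mono of_nat_div_le_of_nat)
  also have "\<dots> = Q * (\<Sum>s'<m. potential N A S b (p s'))"
    by (simp only: e sum_distrib_left)
  also have "\<dots> \<le> Q * (real m * x)" using avg by (intro mult_left_mono) auto
  finally have c: "(\<Sum>v\<in>A. ?c s v) \<le> Q * x"
    using assms(3) by (simp add: mult.left_commute)
  have "Q * potential N A S b (p s) \<le> (\<Sum>v\<in>A. ?c s v + 1)"
    unfolding e[symmetric] scaled_cost_def by (intro sum_mono real_divide_le_div_add_1)
  also have "\<dots> = (\<Sum>v\<in>A. ?c s v) + card A" by (simp add: sum.distrib)
  finally have "Q * potential N A S b (p s) \<le> Q * x + card A" using c by linarith
  then show ?thesis using assms(2) by (simp add: field_simps)
qed

section \<open>One phase\<close>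

text \<open>Neighbors outside \<open>A\<close> have their final colors, and \<open>col\<close> is
  public; so a node prunes its list without communication.\<close>

definition current :: "nat set \<Rightarrow> (nat \<Rightarrow> nat) \<Rightarrow> local_input \<Rightarrow> nat set" where
  "current A col q = snd q - col ` (fst q - A)"

text \<open>The modulus is \<open>M = n ^ c\<close>, so the \<open>M * M\<close> seeds are exactly
  the numbers with \<open>2 * c\<close> digits in base \<open>n\<close>, as \<open>vote\<close>
  produces them. The thresholds \<open>t\<close> are public, hence so is the refined prefix of every
  active node.\<close>

definition split :: "nat set \<Rightarrow> nat \<Rightarrow> nat \<Rightarrow> nat set \<Rightarrow> (nat \<Rightarrow> nat) \<Rightarrow> nat \<Rightarrow> nat \<Rightarrow> (nat \<Rightarrow> nat) \<Rightarrow>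
    (nat \<Rightarrow> nat) prog" where
  "split V c Q A col B b p = bind
     (gather V A (B - 1) (\<lambda>u q j. threshold (card V ^ c) (current A col q) b B (p u) (Suc j)))
     (\<lambda>t. bind
       (vote V (\<lambda>u q s. if u \<in> A then scaled_cost Q (\<lambda>_. fst q) A (\<lambda>_. current A col q) b
            (refined (card V ^ c) B t p s) u else 0) (2 * c) 0)
       (\<lambda>s. Ret (refined (card V ^ c) B t p s)))"

primrec splits :: "nat set \<Rightarrow> nat \<Rightarrow> nat \<Rightarrow> nat set \<Rightarrow> (nat \<Rightarrow> nat) \<Rightarrow> nat \<Rightarrow> nat \<Rightarrow> (nat \<Rightarrow> nat) \<Rightarrow>
    (nat \<Rightarrow> nat) prog" where
  "splits V c Q A col B 0 p = Ret p"
| "splits V c Q A col B (Suc r) p = bind (split V c Q A col B (B ^ r) p) (splits V c Q A col B r)"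

definition base :: "nat set \<Rightarrow> nat set \<Rightarrow> nat" where
  "base V A = 1 + card V div card A"

definition digits :: "nat \<Rightarrow> nat \<Rightarrow> nat" where
  "digits C B = (LEAST r. C \<le> B ^ r)"

definition phase :: "nat set \<Rightarrow> nat \<Rightarrow> nat \<Rightarrow> nat \<Rightarrow> nat set \<times> (nat \<Rightarrow> nat) \<Rightarrow>
    (nat set \<times> (nat \<Rightarrow> nat)) prog" where
  "phase V c Q C = (\<lambda>(A, col). if A = {} then Ret (A, col) else bind
     (splits V c Q A col (base V A) (digits C (base V A)) (\<lambda>_. 0))
     (\<lambda>p. bind
       (broadcast (\<lambda>v q. if \<exists>u\<in>fst q \<inter> A. u < v \<and> p u = p v then 1 else 0))
       (\<lambda>d. Ret ({v \<in> A. d v \<noteq> 0}, \<lambda>v. if v \<in> A \<and> d v = 0 then p v else col v))))"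

lemma threshold_le: 
  assumes "finite S" "j \<le> B" "B > 0"
  shows "threshold M S b B y j \<le> M"
proof -
  have "cumulative S b (y * B) j \<le> cumulative S b (y * B) B"
    unfolding cumulative_def using assms by (intro card_mono) auto
  then have "threshold M S b B y j \<le> cumulative S b (y * B) B * M div cumulative S b (y * B) B"
    unfolding threshold_def by (intro div_le_mono mult_right_mono) auto
  also have "\<dots> \<le> M" by simp
  finally show ?thesis .
qed

text \<open>The crude bound by \<open>C\<close> serves to control the error accumulated over all
  digits, in \<open>growth_le\<close>.\<close>

lemma le_digits:
  assumes "B \<ge> 2"
  shows "C \<le> B ^ digits C B" "digits C B \<le> C"
proof -
  have "C \<le> 2 ^ C" by (simp add: less_imp_le)
  also have "\<dots> \<le> B ^ C" using assms by (intro power_mono) auto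
  finally have *: "C \<le> B ^ C" .
  show "C \<le> B ^ digits C B" unfolding digits_def by (rule LeastI[of "\<lambda>r. C \<le> B ^ r", OF *])
  show "digits C B \<le> C" unfolding digits_def by (rule Least_le[of "\<lambda>r. C \<le> B ^ r", OF *])
qed

text \<open>Swapping the endpoints matches conflicts with smaller neighbors to conflicts with larger
  ones, so either kind makes up half of the sum.\<close>

lemma conflicts_below:
  assumes "finite A" and sym: "\<And>u v. u \<in> A \<Longrightarrow> v \<in> A \<Longrightarrow> u \<in> N v \<longleftrightarrow> v \<in> N u"
    and irrefl: "\<And>v. v \<in> A \<Longrightarrow> v \<notin> N v"
  shows "2 * (\<Sum>v\<in>A. card {u \<in> conflicts N A p v. u < v}) = (\<Sum>v\<in>A. card (conflicts N A p v))"
proof -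
  let ?L = "\<lambda>v. {u \<in> conflicts N A p v. u < v}" and ?G = "\<lambda>v. {u \<in> conflicts N A p v. v < u}"
  have fin: "finite (conflicts N A p v)" for v using assms(1) by (simp add: conflicts_def)
  have "(\<Sum>v\<in>A. card (?L v)) = card (Sigma A ?L)" "(\<Sum>v\<in>A. card (?G v)) = card (Sigma A ?G)"
    using assms(1) fin by simp_all
  moreover have "card (Sigma A ?L) = card (Sigma A ?G)"
  proof (rule bij_betw_same_card)
    show "bij_betw prod.swap (Sigma A ?L) (Sigma A ?G)"
      by (rule bij_betw_byWitness[where f' = prod.swap]) (auto simp: conflicts_def sym)
  qed
  moreover have "card (conflicts N A p v) = card (?L v) + card (?G v)" if "v \<in> A" for v
  proof -
    have "conflicts N A p v = ?L v \<union> ?G v"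
      using irrefl[OF that] by (auto simp: conflicts_def) (metis linorder_neqE_nat)
    moreover have "?L v \<inter> ?G v = {}" by auto
    ultimately show ?thesis using fin[of v] by (metis (no_types, lifting) card_Un_disjoint finite_Un)
  qed
  ultimately show ?thesis by (simp add: sum.distrib)
qed

text \<open>\<epsilon> is the relative error allowed per digit, once for hashing and once for
  rounding. The first precision condition is restricted to \<open>n \<ge> 2\<close> because powers
  of 1 do not grow.\<close>

locale coloring_clique = clique +
  fixes c Q D C :: nat and \<epsilon> :: real
  assumes neighbors_subset: "\<And>v. v \<in> V \<Longrightarrow> fst (P v) \<subseteq> V"
    and irrefl: "\<And>v. v \<in> V \<Longrightarrow> v \<notin> fst (P v)"
    and symmetric: "\<And>u v. u \<in> V \<Longrightarrow> v \<in> V \<Longrightarrow> u \<in> fst (P v) \<longleftrightarrow> v \<in> fst (P u)"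
    and lists: "\<And>v. v \<in> V \<Longrightarrow> snd (P v) \<subseteq> {..<C}"
      "\<And>v. v \<in> V \<Longrightarrow> card (fst (P v)) + 1 \<le> card (snd (P v))"
    and ids: "\<And>v. v \<in> V \<Longrightarrow> v \<le> D"
    and packets: "1 < Z" "n ^ c < Z" "n * n ^ (2 * c) * (Q * n) < Z"
    and precision: "n \<ge> 2 \<Longrightarrow> 3 * real (C * (1 + 2 * D)) \<le> \<epsilon> * real (n ^ c)"
      "Q > 0" "1 / real Q \<le> \<epsilon>" "8 * \<epsilon> * real C \<le> 1" "\<epsilon> \<le> 1"
begin

abbreviation "N v \<equiv> fst (P v)"

text \<open>The invariant between phases: \<open>col\<close> is a proper list coloring of the nodes
  that are no longer active.\<close>

definition good :: "nat set \<Rightarrow> (nat \<Rightarrow> nat) \<Rightarrow> bool" where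
  "good A col \<longleftrightarrow> A \<subseteq> V \<and> (\<forall>v\<in>V - A. col v \<in> snd (P v)) \<and>
     (\<forall>v\<in>V - A. \<forall>u\<in>N v - A. col u \<noteq> col v)"

lemma \<epsilon>_nonneg: "\<epsilon> \<ge> 0"
proof -
  have "0 \<le> 1 / real Q" by simp
  then show ?thesis using precision(3) by linarith
qed

lemma finite_N: "v \<in> V \<Longrightarrow> finite (N v)"
  using neighbors_subset finite_V finite_subset by blast

lemma finite_list: "v \<in> V \<Longrightarrow> finite (snd (P v))"
  using lists(1) finite_subset by blast

lemma finite_current: "v \<in> V \<Longrightarrow> finite (current A col (P v))"
  using finite_list by (simp add: current_def)

lemma card_current_le:
  assumes "v \<in> V"
  shows "card (current A col (P v)) \<le> C"
proof -
  have "card (current A col (P v)) \<le> card {..<C}"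
    using lists(1)[OF assms] by (intro card_mono) (auto simp: current_def)
  then show ?thesis by simp
qed

text \<open>Each colored neighbor removes at most one color, so lists stay larger than the number of
  active neighbors.\<close>

lemma card_current_ge:
  assumes "v \<in> V"
  shows "card (N v \<inter> A) + 1 \<le> card (current A col (P v))"
proof -
  have "card (N v) = card (N v \<inter> A) + card (N v - A)"
    using finite_N[OF assms] by (metis card_Int_Diff)
  moreover have "card (col ` (N v - A)) \<le> card (N v - A)"
    using finite_N[OF assms] by (intro card_image_le) auto
  moreover have "card (snd (P v)) - card (col ` (N v - A)) \<le> card (current A col (P v))"
    unfolding current_def using finite_N[OF assms] by (intro diff_card_le_card_Diff) auto
  ultimately show ?thesis using lists(2)[OF assms] by linarith
qed

lemma steps_split [simp]: "steps (split V c Q A col B b p) = 1 + 2 * c"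
  by (simp add: split_def)

lemma val_split:
  assumes A: "A \<subseteq> V" "card A * (B - 1) \<le> n" and B: "B > 0"
    and ne: "\<And>v. v \<in> A \<Longrightarrow> block (current A col (P v)) (b * B) (p v) \<noteq> {}"
  defines "S \<equiv> \<lambda>v. current A col (P v)" and "p' \<equiv> val (split V c Q A col B b p)"
  shows "\<forall>v\<in>A. block (S v) b (p' v) \<noteq> {}"
    and "potential N A S b p' \<le> (1 + \<epsilon>) * potential N A S (b * B) p + card A / Q"
proof -
  define M where "M = n ^ c"
  let ?x = "\<lambda>u q j. threshold M (current A col q) b B (p u) (Suc j)"
  define t where "t = val (gather V A (B - 1) ?x)"
  let ?cost = "\<lambda>u q s. if u \<in> A then scaled_cost Q (\<lambda>_. fst q) A (\<lambda>_. current A col q) b (refined M B t p s) u else 0"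
  define s where "s = val (vote V ?cost (2 * c) 0)"
  have p': "p' = refined M B t p s"
    unfolding p'_def split_def s_def t_def M_def by (simp only: value_of_bind value_of.simps)
  have finA: "finite A" using A finite_V finite_subset by blast
  have finS: "finite (S v)" if "v \<in> A" for v using finite_current that A by (auto simp: S_def)
  have M: "M > 0" using n_pos by (simp add: M_def)
  have t: "t u j = threshold M (S u) b B (p u) (Suc j)" if "u \<in> A" "j < B - 1" for u j
  proof -
    have "?x u (P u) j \<le> M" using finS[OF that(1)] that(2) B by (intro threshold_le) (auto simp: S_def)
    then have "?x u (P u) j < Z" using packets(2) by (simp add: M_def)
    then show ?thesis unfolding t_def S_def using val_gather[OF A that, of ?x] by blast
  qed
  have ne': "block (S v) (b * B) (p v) \<noteq> {}" if "v \<in> A" for v using ne[OF that] by (simp add: S_def)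
  show "\<forall>v\<in>A. block (S v) b (p' v) \<noteq> {}"
    unfolding p' using refined_nonempty[of A S b B p t M] finA finS ne' t M B by blast
  have nonneg: "potential N A S b q \<ge> 0" for b q
    unfolding potential_def by (intro sum_nonneg) auto
  show "potential N A S b p' \<le> (1 + \<epsilon>) * potential N A S (b * B) p + card A / Q"
  \<comment> \<open>A single node has no conflicts, so its potential is 0 for every seed.\<close>
  proof (cases "n \<ge> 2")
    case False
    then have "n = 1" using n_pos by linarith
    then obtain w where w: "V = {w}" by (meson card_1_singletonE)
    have "conflicts N A q v = {}" if "v \<in> A" for v q
      using that A irrefl[of w] by (auto simp: conflicts_def w)
    then have "potential N A S b p' = 0" by (simp add: potential_def)
    then show ?thesis using nonneg \<epsilon>_nonneg by simp
  next
    case True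
    \<comment> \<open>A voter inserts its own neighbors and list as constant functions; at that node
      \<open>scaled_cost\<close> looks at no other values.\<close>
    have sum_cost: "(\<Sum>u\<in>V. ?cost u (P u) s) = (\<Sum>u\<in>A. scaled_cost Q N A S b (refined M B t p s) u)" for s
    proof -
      have "(\<Sum>u\<in>V. ?cost u (P u) s) = (\<Sum>u\<in>A. ?cost u (P u) s)"
        using A finite_V by (intro sum.mono_neutral_right) auto
      also have "\<dots> = (\<Sum>u\<in>A. scaled_cost Q N A S b (refined M B t p s) u)"
        by (intro sum.cong) (auto simp: scaled_cost_def conflicts_def S_def)
      finally show ?thesis .
    qed
    have cost_le: "?cost u (P u) s \<le> Q * n" if "u \<in> V" for u s
    proof -
      have "card (conflicts (\<lambda>_. N u) A (refined M B t p s) u) \<le> n"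
        using A finite_V by (intro card_mono) (auto simp: conflicts_def)
      then have "Q * card (conflicts (\<lambda>_. N u) A (refined M B t p s) u) \<le> Q * n" by simp
      then show ?thesis unfolding scaled_cost_def
        by (auto intro: order_trans[OF div_le_dividend])
    qed
    have MM: "n ^ (2 * c) = M * M" by (simp add: M_def mult_2 power_add)
    have "(\<Sum>u\<in>V. ?cost u (P u) s) * n ^ (2 * c) \<le> (\<Sum>s<n ^ (2 * c). \<Sum>u\<in>V. ?cost u (P u) (0 * n ^ (2 * c) + s))"
      unfolding s_def using val_vote[of ?cost "Q * n" "2 * c" 0, OF cost_le packets(3)] by blast
    then have min: "(\<Sum>v\<in>A. scaled_cost Q N A S b (refined M B t p s) v) * (M * M) \<le>
        (\<Sum>s<M * M. \<Sum>v\<in>A. scaled_cost Q N A S b (refined M B t p s) v)"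
      by (simp only: sum_cost MM mult_zero_left add_0_left)
    have "(\<Sum>s<M * M. potential N A S b (refined M B t p s)) \<le>
        real (M * M) * ((1 + \<epsilon>) * potential N A S (b * B) p)"
    proof -
      have "(\<Sum>s<M * M. potential N A S b (refined M B t p s)) \<le>
          M * M * (1 + \<epsilon>) * potential N A S (b * B) p"
      proof (rule expected_potential[where D = D and K = C])
        show "3 * real (C * (1 + 2 * D)) \<le> \<epsilon> * real M"
          using precision(1)[OF True] by (simp add: M_def)
      qed (use finA finS ne' t M B irrefl ids card_current_le A precision(5) in \<open>auto simp: S_def\<close>)
      then show ?thesis by (simp add: mult.assoc)
    qed
    from potential_of_scaled_cost[OF finA precision(2) _ min this] M
    show ?thesis unfolding p' by simp
  qed
qed

lemma steps_splits [simp]: "steps (splits V c Q A col B r p) = r * (1 + 2 * c)"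
  by (induction r arbitrary: p) (auto simp: algebra_simps)

text \<open>\<open>k\<close> digits have been processed before. Every digit costs a factor
  \<open>1 + 2 * \<epsilon>\<close>: one \<epsilon> for hashing, and one for the rounding error
  \<open>card A / Q\<close>, absorbed because the bound never falls below
  \<open>card A\<close>.\<close>

lemma val_splits:
  fixes col :: "nat \<Rightarrow> nat"
  assumes A: "A \<subseteq> V" "card A * (B - 1) \<le> n" and B: "B > 0"
  defines "S \<equiv> \<lambda>v. current A col (P v)"
  assumes "\<And>v. v \<in> A \<Longrightarrow> block (S v) (B ^ r) (p v) \<noteq> {}"
    and "potential N A S (B ^ r) p \<le> card A * (1 + 2 * \<epsilon>) ^ k"
  shows "(\<forall>v\<in>A. block (S v) 1 (val (splits V c Q A col B r p) v) \<noteq> {}) \<and>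
    potential N A S 1 (val (splits V c Q A col B r p)) \<le> card A * (1 + 2 * \<epsilon>) ^ (k + r)"
  using assms(5,6)
proof (induction r arbitrary: p k)
  case (Suc r)
  let ?p = "val (split V c Q A col B (B ^ r) p)"
  have *: "\<forall>v\<in>A. block (S v) (B ^ r) (?p v) \<noteq> {}"
    "potential N A S (B ^ r) ?p \<le> (1 + \<epsilon>) * potential N A S (B ^ Suc r) p + card A / Q"
    using val_split[OF A B, of col "B ^ r" p] Suc.prems(1) unfolding S_def by (simp_all add: mult.commute)
  note *(2)
  also have "(1 + \<epsilon>) * potential N A S (B ^ Suc r) p + card A / Q \<le>
      (1 + \<epsilon>) * (card A * (1 + 2 * \<epsilon>) ^ k) + card A * (\<epsilon> * (1 + 2 * \<epsilon>) ^ k)"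
  proof (rule add_mono)
    show "(1 + \<epsilon>) * potential N A S (B ^ Suc r) p \<le> (1 + \<epsilon>) * (card A * (1 + 2 * \<epsilon>) ^ k)"
      using Suc.prems(2) \<epsilon>_nonneg by (intro mult_left_mono) auto
    have "1 \<le> (1 + 2 * \<epsilon>) ^ k" using \<epsilon>_nonneg by (intro one_le_power) auto
    then have "\<epsilon> * 1 \<le> \<epsilon> * (1 + 2 * \<epsilon>) ^ k" using \<epsilon>_nonneg by (intro mult_left_mono) auto
    then have "1 / Q \<le> \<epsilon> * (1 + 2 * \<epsilon>) ^ k" using precision(3) by linarith
    then have "card A * (1 / Q) \<le> card A * (\<epsilon> * (1 + 2 * \<epsilon>) ^ k)" by (intro mult_left_mono) auto
    then show "card A / Q \<le> card A * (\<epsilon> * (1 + 2 * \<epsilon>) ^ k)" by simp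
  qed
  also have "\<dots> = card A * (1 + 2 * \<epsilon>) ^ Suc k" by (simp add: algebra_simps)
  finally show ?case
    using Suc.IH[of ?p "Suc k"] *(1) by simp
qed simp

lemma base_props:
  assumes "A \<subseteq> V" "A \<noteq> {}"
  shows "base V A \<ge> 2" "card A * (base V A - 1) \<le> n"
proof -
  have "card A > 0" "card A \<le> n"
    using assms finite_V by (auto simp: card_gt_0_iff finite_subset card_mono)
  then have "n div card A \<ge> 1" by (simp add: div_greater_zero_iff Suc_leI)
  then show "base V A \<ge> 2" by (simp add: base_def)
  show "card A * (base V A - 1) \<le> n" by (simp add: base_def)
qed

lemma steps_phase:
  "steps (phase V c Q C (A, col)) = (if A = {} then 0 else digits C (base V A) * (1 + 2 * c) + 1)"
  by (simp add: phase_def)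

text \<open>There are at most \<open>C\<close> digits and \<open>8 * \<epsilon> * C \<le> 1\<close>,
  so the growth is at most \<open>exp (1 / 4)\<close>.\<close>

lemma growth_le: "r \<le> C \<Longrightarrow> (1 + 2 * \<epsilon>) ^ r \<le> 3 / 2"
proof -
  assume "r \<le> C"
  then have "r * (2 * \<epsilon>) \<le> C * (2 * \<epsilon>)" using \<epsilon>_nonneg by (intro mult_right_mono) auto
  also have "\<dots> = 8 * \<epsilon> * C / 4" by simp
  also have "\<dots> \<le> 1 / 4" using precision(4) by (rule divide_right_mono) simp
  finally have *: "r * (2 * \<epsilon>) \<le> 1 / 4" .
  have "(1 + 2 * \<epsilon>) ^ r \<le> exp (2 * \<epsilon>) ^ r"
    using \<epsilon>_nonneg by (intro power_mono exp_ge_add_one_self) auto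
  also have "\<dots> = exp (r * (2 * \<epsilon>))" by (simp add: exp_of_nat_mult)
  also have "\<dots> \<le> exp (1 / 4)" using * by simp
  also have "\<dots> \<le> 1 + 1 / 4 + (1 / 4)\<^sup>2" by (intro exp_bound) auto
  also have "\<dots> \<le> 3 / 2" by (simp add: power2_eq_square)
  finally show ?thesis .
qed

text \<open>The potential starts at most at \<open>card A\<close> and ends at most at
  \<open>3 / 2 * card A\<close>, where it counts every conflicting edge twice. Each node that stays
  active owns an edge to a smaller neighbor, so
  \<open>2 * card A' \<le> 3 / 2 * card A\<close>.\<close>

lemma val_phase:
  assumes "good A col" and "val (phase V c Q C (A, col)) = (A', col')"
  shows "good A' col' \<and> card A' \<le> 3 / 4 * card A"
proof (cases "A = {}")
  case True
  then show ?thesis using assms by (simp add: phase_def)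
next
  case False
  let ?B = "base V A" and ?S = "\<lambda>v. current A col (P v)"
  let ?r = "digits C ?B"
  have A: "A \<subseteq> V" using assms(1) by (simp add: good_def)
  have finA: "finite A" using A finite_V finite_subset by blast
  define p where "p = val (splits V c Q A col ?B ?r (\<lambda>_. 0))"
  have S_ge: "card (N v \<inter> A) + 1 \<le> card (?S v)" if "v \<in> A" for v
    using card_current_ge that A by blast
  \<comment> \<open>Before the first digit the prefix is 0; since \<open>C \<le> B ^ r\<close>, its
    block is the entire list.\<close>
  have block0: "block (?S v) (?B ^ ?r) 0 = ?S v" if "v \<in> A" for v
  proof -
    have "?S v \<subseteq> {..<C}" using lists(1)[of v] that A by (auto simp: current_def)
    moreover have "C \<le> ?B ^ ?r" using le_digits(1) base_props(1)[OF A False] .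
    ultimately show ?thesis by (fastforce simp: block_def)
  qed
  have "(\<forall>v\<in>A. block (?S v) 1 (p v) \<noteq> {}) \<and>
      potential N A ?S 1 p \<le> card A * (1 + 2 * \<epsilon>) ^ (0 + ?r)"
    unfolding p_def
  proof (rule val_splits[OF A base_props(2)[OF A False]])
    show "0 < ?B" by (simp add: base_def)
    show "block (?S v) (?B ^ ?r) 0 \<noteq> {}" if "v \<in> A" for v
      using S_ge[OF that] unfolding block0[OF that] by force
    \<comment> \<open>With empty prefixes all active neighbors conflict, and the list has more
      colors than that.\<close>
    have "potential N A ?S (?B ^ ?r) (\<lambda>_. 0) \<le> (\<Sum>v\<in>A. 1)"
      unfolding potential_def
    proof (rule sum_mono)
      fix v assume v: "v \<in> A"
      have "card (conflicts N A (\<lambda>_. 0) v) \<le> card (?S v)"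
        using S_ge[OF v] by (simp add: conflicts_def Int_def)
      then show "real (card (conflicts N A (\<lambda>_. 0) v)) / real (card (block (?S v) (?B ^ ?r) 0)) \<le> 1"
        unfolding block0[OF v] by (simp add: divide_le_eq_1) linarith
    qed
    then show "potential N A ?S (?B ^ ?r) (\<lambda>_. 0) \<le> card A * (1 + 2 * \<epsilon>) ^ 0" by simp
  qed
  then have p: "p v \<in> ?S v" if "v \<in> A" for v
    using that by (auto simp: block_def)
  have pot: "potential N A ?S 1 p \<le> card A * (3 / 2)"
  proof -
    have "(1 + 2 * \<epsilon>) ^ ?r \<le> 3 / 2" by (rule growth_le[OF le_digits(2)[OF base_props(1)[OF A False]]])
    then have "card A * (1 + 2 * \<epsilon>) ^ ?r \<le> card A * (3 / 2)" by (intro mult_left_mono) auto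
    then show ?thesis
      using \<open>_ \<and> potential N A ?S 1 p \<le> card A * (1 + 2 * \<epsilon>) ^ (0 + ?r)\<close> by simp
  qed
  let ?bad = "\<lambda>v. \<exists>u\<in>N v \<inter> A. u < v \<and> p u = p v"
  have d: "val (broadcast (\<lambda>v q. if \<exists>u\<in>fst q \<inter> A. u < v \<and> p u = p v then 1 else 0)) v =
      (if ?bad v then 1 else 0)" if "v \<in> A" for v
    using packets(1) that A by (subst val_broadcast) auto
  have A': "A' = {v \<in> A. ?bad v}" and col': "v \<in> A \<Longrightarrow> col' v = (if ?bad v then col v else p v)"
    "v \<notin> A \<Longrightarrow> col' v = col v" for v
    using assms(2) d False by (auto simp: phase_def p_def[symmetric] split: if_splits)
  have good: "good A' col'"
    unfolding good_def
  proof (intro conjI ballI)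
    show "A' \<subseteq> V" using A A' by auto
  next
    fix v assume v: "v \<in> V - A'"
    show "col' v \<in> snd (P v)"
    proof (cases "v \<in> A")
      case True
      then show ?thesis using v p[OF True] by (auto simp: col' A' current_def)
    next
      case False
      then show ?thesis using v assms(1) by (simp add: col' good_def)
    qed
    fix u assume u: "u \<in> N v - A'"
    have uV: "u \<in> V" using u v neighbors_subset[of v] by auto
    then have uv: "u \<in> V" "v \<in> V" "u \<noteq> v" "v \<in> N u"
      using u v irrefl[of v] symmetric[OF uV, of v] by auto
    show "col' u \<noteq> col' v"
    \<comment> \<open>Of two conflicting new nodes the larger one would have stayed active; a new
      color comes from a list pruned by the old colors; two old nodes are covered by the
      invariant.\<close>
    proof (cases "u \<in> A"; cases "v \<in> A")
      assume a: "u \<in> A" "v \<in> A"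
      then have "\<not> ?bad u" "\<not> ?bad v" using u v by (auto simp: A')
      moreover have "u < v \<or> v < u" using uv by linarith
      ultimately show ?thesis using a u uv by (auto simp: col')
    next
      assume a: "u \<in> A" "v \<notin> A"
      then have "\<not> ?bad u" using u by (auto simp: A')
      then show ?thesis using a p[OF a(1)] uv by (auto simp: col' current_def)
    next
      assume a: "u \<notin> A" "v \<in> A"
      then have "\<not> ?bad v" using v by (auto simp: A')
      moreover have "p v \<notin> col ` (N v - A)" "col u \<in> col ` (N v - A)"
        using a p[OF a(2)] u by (auto simp: current_def)
      ultimately show ?thesis using a by (auto simp: col')
    next
      assume a: "u \<notin> A" "v \<notin> A"
      then show ?thesis using assms(1) u v by (auto simp: col' good_def)
    qed
  qed
  have block1: "card (block (?S v) 1 (p v)) = 1" if "v \<in> A" for v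
  proof -
    have "block (?S v) 1 (p v) = {p v}" using p[OF that] by (auto simp: block_def)
    then show ?thesis by simp
  qed
  have "card A' = (\<Sum>v\<in>A'. 1)" by simp
  also have "\<dots> \<le> (\<Sum>v\<in>A'. card {u \<in> conflicts N A p v. u < v})"
  proof (rule sum_mono)
    fix v assume "v \<in> A'"
    then have "{u \<in> conflicts N A p v. u < v} \<noteq> {}" by (auto simp: A' conflicts_def)
    then show "1 \<le> card {u \<in> conflicts N A p v. u < v}"
      using finA by (simp add: Suc_le_eq card_gt_0_iff conflicts_def)
  qed
  also have "\<dots> \<le> (\<Sum>v\<in>A. card {u \<in> conflicts N A p v. u < v})"
    using finA by (intro sum_mono2) (auto simp: A')
  finally have "2 * card A' \<le> 2 * (\<Sum>v\<in>A. card {u \<in> conflicts N A p v. u < v})" by simp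
  also have "\<dots> = (\<Sum>v\<in>A. card (conflicts N A p v))"
    using A by (intro conflicts_below finA symmetric irrefl) blast+
  finally have "real (2 * card A') \<le> real (\<Sum>v\<in>A. card (conflicts N A p v))"
    by (simp only: of_nat_le_iff)
  also have "\<dots> = potential N A ?S 1 p"
    unfolding potential_def of_nat_sum by (intro sum.cong refl) (simp only: block1 of_nat_1 div_by_1)
  finally show ?thesis using pot good by linarith
qed

end

section \<open>The complete algorithm\<close>

text \<open>Indices past the end repeat the last element, so all nodes can fill the same number of
  slots.\<close>

definition listing :: "nat set \<Rightarrow> nat \<Rightarrow> nat" where
  "listing X j = enum X (min j (card X - 1))"

lemma listing_image:
  assumes "finite X" "X \<noteq> {}" "card X \<le> k"
  shows "listing X ` {..<k} = X"
proof -
  have pos: "card X > 0" using assms by (simp add: card_gt_0_iff)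
  have X: "enum X ` {..<card X} = X" using enum_bij[OF assms(1)] by (simp add: bij_betw_def)
  show ?thesis
  proof
    show "listing X ` {..<k} \<subseteq> X"
    proof
      fix x assume "x \<in> listing X ` {..<k}"
      then obtain j where "x = enum X (min j (card X - 1))" by (auto simp: listing_def)
      moreover have "min j (card X - 1) < card X" using pos by linarith
      ultimately have "x \<in> enum X ` {..<card X}" by blast
      then show "x \<in> X" using X by simp
    qed
    show "X \<subseteq> listing X ` {..<k}"
    proof
      fix x assume "x \<in> X"
      then obtain j where j: "j < card X" "x = enum X j" using X by auto
      then have "min j (card X - 1) = j" by linarith
      then have "x = listing X j" using j by (simp only: listing_def)
      then show "x \<in> listing X ` {..<k}" using j assms(3) by auto
    qed
  qed
qed

text \<open>The node inserted last has fewer colored neighbors than colors. Symmetry of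
  \<open>N\<close> makes its choice safe from the viewpoint of its neighbors too.\<close>

lemma greedy_list_coloring:
  fixes N :: "'a \<Rightarrow> 'a set" and S :: "'a \<Rightarrow> 'b set"
  assumes "finite A" "\<And>v. v \<in> A \<Longrightarrow> finite (S v)" "\<And>v. v \<in> A \<Longrightarrow> card (N v \<inter> A) < card (S v)"
    "\<And>v. v \<in> A \<Longrightarrow> v \<notin> N v" "\<And>u v. u \<in> A \<Longrightarrow> v \<in> A \<Longrightarrow> u \<in> N v \<longleftrightarrow> v \<in> N u"
  shows "\<exists>\<psi>. \<forall>v\<in>A. \<psi> v \<in> S v \<and> (\<forall>u\<in>N v \<inter> A. \<psi> u \<noteq> \<psi> v)"
  using assms
proof (induction A rule: finite_induct)
  case (insert x A)
  have less: "card (N v \<inter> A) < card (S v)" if "v \<in> A" for v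
  proof -
    have "card (N v \<inter> A) \<le> card (N v \<inter> insert x A)"
      using insert.hyps(1) by (intro card_mono) auto
    then show ?thesis using insert.prems(2)[of v] that by simp
  qed
  have "\<exists>\<psi>. \<forall>v\<in>A. \<psi> v \<in> S v \<and> (\<forall>u\<in>N v \<inter> A. \<psi> u \<noteq> \<psi> v)"
    by (rule insert.IH; (rule less insert.prems; blast)?)
  then obtain \<psi> where \<psi>: "\<forall>v\<in>A. \<psi> v \<in> S v \<and> (\<forall>u\<in>N v \<inter> A. \<psi> u \<noteq> \<psi> v)" by blast
  have "card (\<psi> ` (N x \<inter> A)) \<le> card (N x \<inter> A)"
    using insert.hyps(1) by (intro card_image_le) auto
  also have "card (N x \<inter> A) = card (N x \<inter> insert x A)"
    using insert.prems(3)[of x] by (intro arg_cong[of _ _ card]) auto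
  also have "\<dots> < card (S x)" using insert.prems(2) by simp
  finally have "\<not> S x \<subseteq> \<psi> ` (N x \<inter> A)"
    using insert.hyps(1) card_mono[of "\<psi> ` (N x \<inter> A)" "S x"] by auto
  then obtain y where y: "y \<in> S x" "y \<notin> \<psi> ` (N x \<inter> A)" by blast
  have "(\<psi>(x := y)) v \<in> S v \<and> (\<forall>u\<in>N v \<inter> insert x A. (\<psi>(x := y)) u \<noteq> (\<psi>(x := y)) v)"
    if v: "v \<in> insert x A" for v
  proof (cases "v = x")
    case True
    then show ?thesis using y insert.prems(3)[of x] by auto
  next
    case False
    then have "v \<in> A" using v by simp
    moreover have "\<psi> v \<noteq> y" if "x \<in> N v"
      using that y(2) insert.prems(4)[of x v] \<open>v \<in> A\<close> by auto
    ultimately show ?thesis using \<psi> False by auto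
  qed
  then show ?case by blast
qed simp

text \<open>Lists may be far longer than the degree; one color more than active neighbors is enough
  for the greedy argument and keeps the published data small.\<close>

definition palette :: "nat set \<Rightarrow> (nat \<Rightarrow> nat) \<Rightarrow> local_input \<Rightarrow> nat set" where
  "palette A col q = (SOME X. X \<subseteq> current A col q \<and> card X = card (fst q \<inter> A) + 1)"

text \<open>The node itself is added to its active neighbors because \<open>listing\<close> needs a nonempty set.\<close>

definition finish :: "nat set \<Rightarrow> nat \<Rightarrow> nat set \<Rightarrow> (nat \<Rightarrow> nat) \<Rightarrow> (nat \<Rightarrow> nat) prog" where
  "finish V k A col = bind
     (gather V A (2 * k) (\<lambda>u q j. if j < k then listing (palette A col q) j
        else listing (insert u (fst q \<inter> A)) (j - k)))
     (\<lambda>t. Ret (\<lambda>v. if v \<in> A then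
        (SOME \<psi>. \<forall>v\<in>A. \<psi> v \<in> t v ` {..<k} \<and> (\<forall>u\<in>t v ` {k..<2 * k} - {v}. \<psi> u \<noteq> \<psi> v)) v
        else col v))"

primrec phases where
  "phases V c Q C 0 x = Ret x"
| "phases V c Q C (Suc i) x = bind (phase V c Q C x) (phases V c Q C i)"

text \<open>Three phases at least halve the active set, since
  \<open>(3 / 4) ^ 3 \<le> 1 / 2\<close>; this many bring it down to \<open>n / (2 * k)\<close>, the
  size at which \<open>finish\<close> fits into the clique.\<close>

definition phase_count :: "nat \<Rightarrow> nat" where
  "phase_count k = 3 * floorlog 2 (2 * k)"

text \<open>Nodes know neither the maximum degree nor the color space, so two broadcasts determine
  them. The value \<open>C\<close> found is one more than the largest color in a list and may be
  below the size of the given color space.\<close>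

definition color_lists :: "nat \<Rightarrow> nat \<Rightarrow> nat set \<Rightarrow> (nat \<Rightarrow> nat) prog" where
  "color_lists c Q V = bind (broadcast (\<lambda>v q. card (fst q)))
     (\<lambda>d. bind (broadcast (\<lambda>v q. Max (snd q)))
       (\<lambda>m. let k = Suc (Max (d ` V)); C = Suc (Max (m ` V)) in
         bind (phases V c Q C (phase_count k) (V, \<lambda>_. 0)) (\<lambda>(A, col). finish V k A col)))"

lemma phase_count_shrinks: "(3 / 4) ^ phase_count k * real (2 * k) \<le> 1"
proof -
  let ?f = "floorlog 2 (2 * k)"
  have "2 * k < 2 ^ ?f \<or> k = 0" using floorlog_bounds[of "2 * k" 2] by auto
  then have "real (2 * k) \<le> 2 ^ ?f"
    by (metis less_imp_le mult_0_right of_nat_0 of_nat_le_numeral_power_cancel_iff zero_le_numeral zero_le_power)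
  moreover have "(3 / 4 :: real) ^ phase_count k \<le> (1 / 2) ^ ?f"
  proof -
    have "(3 / 4 :: real) ^ phase_count k = ((3 / 4) ^ 3) ^ ?f"
      by (simp only: phase_count_def power_mult)
    also have "\<dots> \<le> (1 / 2) ^ ?f" by (intro power_mono) (auto simp: power3_eq_cube)
    finally show ?thesis .
  qed
  ultimately have "(3 / 4) ^ phase_count k * real (2 * k) \<le> (1 / 2) ^ ?f * 2 ^ ?f"
    by (intro mult_mono) auto
  also have "\<dots> = 1" by (simp flip: power_mult_distrib)
  finally show ?thesis .
qed

lemma digits_le:
  assumes "B \<ge> 2" "C \<ge> 1"
  shows "digits C B \<le> 1 + log 2 C / log 2 B"
proof (cases "digits C B")
  case 0
  then show ?thesis using assms by simp
next
  case (Suc r)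
  then have "\<not> C \<le> B ^ r" unfolding digits_def by (intro not_less_Least) simp
  then have "real (B ^ r) < C" by simp
  moreover have "real (B ^ r) > 0" using assms by simp
  ultimately have "log 2 (real (B ^ r)) < log 2 C" by simp
  then have "r * log 2 B < log 2 C" using assms by (simp add: log_nat_power)
  then have "r \<le> log 2 C / log 2 B" using assms by (simp add: field_simps)
  then show ?thesis using Suc by simp
qed

section \<open>The final step, and the shrinking of the active set over the phases\<close>

context coloring_clique
begin

text \<open>Of the \<open>2 * k\<close> numbers that each active node publishes, \<open>k\<close>
  list its palette and \<open>k\<close> its active neighbors and itself. This determines the
  remaining instance, so everyone selects the same greedy coloring.\<close>

lemma val_finish:
  assumes good: "good A col" and k: "card A * (2 * k) \<le> n" "\<And>v. v \<in> V \<Longrightarrow> card (N v) < k"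
    and Z: "C \<le> Z" "D < Z"
  defines "\<phi> \<equiv> val (finish V k A col)"
  shows "\<forall>v\<in>V. \<phi> v \<in> snd (P v) \<and> (\<forall>u\<in>N v. \<phi> u \<noteq> \<phi> v)"
proof -
  have A: "A \<subseteq> V" using good by (simp add: good_def)
  have finA: "finite A" using A finite_V finite_subset by blast
  let ?x = "\<lambda>u q j. if j < k then listing (palette A col q) j else listing (insert u (fst q \<inter> A)) (j - k)"
  define t where "t = val (gather V A (2 * k) ?x)"
  have pal: "palette A col (P v) \<subseteq> current A col (P v) \<and> card (palette A col (P v)) = card (N v \<inter> A) + 1"
    if "v \<in> A" for v
    unfolding palette_def
    by (rule someI_ex[of "\<lambda>X. X \<subseteq> current A col (P v) \<and> card X = card (N v \<inter> A) + 1"])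
       (use card_current_ge[of v A col] that A in \<open>metis obtain_subset_with_card_n subsetD\<close>)
  have deg: "card (N v \<inter> A) < k" if "v \<in> A" for v
  proof -
    have "card (N v \<inter> A) \<le> card (N v)" using finite_N[of v] that A by (intro card_mono) auto
    then show ?thesis using k(2)[of v] that A by auto
  qed
  have pal_img: "listing (palette A col (P v)) ` {..<k} = palette A col (P v)" if "v \<in> A" for v
  proof (rule listing_image)
    show fin: "finite (palette A col (P v))"
      using pal[OF that] by (metis add_is_0 card.infinite one_neq_zero)
    show "palette A col (P v) \<noteq> {}" using pal[OF that] by auto
    show "card (palette A col (P v)) \<le> k" using pal[OF that] deg[OF that] by simp
  qed
  have nb_img: "listing (insert v (N v \<inter> A)) ` {..<k} = insert v (N v \<inter> A)" if "v \<in> A" for v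
  proof (rule listing_image)
    show "card (insert v (N v \<inter> A)) \<le> k"
      using deg[OF that] finA by (simp add: card_insert_if)
  qed (use finA in auto)
  have x_less: "?x v (P v) j < Z" if "v \<in> A" "j < 2 * k" for v j
  proof (cases "j < k")
    case True
    then have "?x v (P v) j \<in> palette A col (P v)" using pal_img[OF that(1)] by auto
    moreover have "palette A col (P v) \<subseteq> {..<C}"
      using pal[OF that(1)] lists(1)[of v] that A by (auto simp: current_def)
    ultimately have "?x v (P v) j < C" by blast
    then show ?thesis using Z by linarith
  next
    case False
    then have "j - k < k" using that by linarith
    then have "?x v (P v) j \<in> insert v (N v \<inter> A)" using nb_img[OF that(1)] False by auto
    then have "?x v (P v) j \<le> D" using ids A that by auto
    then show ?thesis using Z by linarith
  qed
  have t: "t v j = ?x v (P v) j" if "v \<in> A" "j < 2 * k" for v j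
    unfolding t_def using val_gather[OF A k(1) that, of ?x] x_less[OF that] by blast
  have t_pal: "t v ` {..<k} = palette A col (P v)" if "v \<in> A" for v
  proof -
    have "t v ` {..<k} = listing (palette A col (P v)) ` {..<k}"
      using t[OF that] by (intro image_cong) auto
    then show ?thesis using pal_img[OF that] by simp
  qed
  have t_nb: "t v ` {k..<2 * k} - {v} = N v \<inter> A" if "v \<in> A" for v
  proof -
    have "t v ` {k..<2 * k} = (\<lambda>j. listing (insert v (N v \<inter> A)) (j - k)) ` {k..<2 * k}"
      using t[OF that] by (intro image_cong) auto
    also have "\<dots> = listing (insert v (N v \<inter> A)) ` ((\<lambda>j. j - k) ` {k..<2 * k})"
      by (simp add: image_image)
    also have "(\<lambda>j. j - k) ` {k..<2 * k} = {..<k}"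
    proof
      show "{..<k} \<subseteq> (\<lambda>j. j - k) ` {k..<2 * k}"
        by (auto intro!: image_eqI[of _ _ "_ + k"])
    qed auto
    finally show ?thesis using nb_img[OF that] irrefl[of v] that A by auto
  qed
  let ?ok = "\<lambda>\<psi>. \<forall>v\<in>A. \<psi> v \<in> t v ` {..<k} \<and> (\<forall>u\<in>t v ` {k..<2 * k} - {v}. \<psi> u \<noteq> \<psi> v)"
  define \<psi> where "\<psi> = (SOME \<psi>. ?ok \<psi>)"
  have "\<exists>\<psi>. \<forall>v\<in>A. \<psi> v \<in> palette A col (P v) \<and> (\<forall>u\<in>N v \<inter> A. \<psi> u \<noteq> \<psi> v)"
  proof (rule greedy_list_coloring[OF finA])
    fix v assume v: "v \<in> A"
    show "finite (palette A col (P v))"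
      using pal[OF v] by (metis add_is_0 card.infinite one_neq_zero)
    show "card (N v \<inter> A) < card (palette A col (P v))" using pal[OF v] by simp
    show "v \<notin> N v" using irrefl v A by auto
    show "u \<in> N v \<longleftrightarrow> v \<in> N u" if "u \<in> A" for u using symmetric[of u v] that v A by auto
  qed
  then have "\<exists>\<psi>. ?ok \<psi>" by (simp add: t_pal t_nb)
  then have "?ok \<psi>" unfolding \<psi>_def by (rule someI_ex)
  then have ok: "\<forall>v\<in>A. \<psi> v \<in> palette A col (P v) \<and> (\<forall>u\<in>N v \<inter> A. \<psi> u \<noteq> \<psi> v)"
    by (simp add: t_pal t_nb)
  have \<psi>: "\<psi> v \<in> current A col (P v)" "\<forall>u\<in>N v \<inter> A. \<psi> u \<noteq> \<psi> v" if "v \<in> A" for v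
    using ok pal[OF that] that by blast+
  have \<phi>: "\<phi> v = (if v \<in> A then \<psi> v else col v)" for v
    unfolding \<phi>_def finish_def \<psi>_def t_def by (simp only: value_of_bind value_of.simps)
  show ?thesis
  proof (intro ballI conjI)
    fix v assume v: "v \<in> V"
    show "\<phi> v \<in> snd (P v)"
      using \<psi>(1)[of v] good v by (auto simp: \<phi> current_def good_def)
    fix u assume u: "u \<in> N v"
    have uV: "u \<in> V" using u v neighbors_subset by auto
    have vu: "v \<in> N u" using u symmetric[OF uV v] by simp
    have *: "\<psi> x \<noteq> col y" if "x \<in> A" "y \<in> N x" "y \<notin> A" for x y
      using \<psi>(1)[OF that(1)] that by (auto simp: current_def)
    show "\<phi> u \<noteq> \<phi> v"
      using \<psi>(2)[of v] *[of v u] *[of u v] good u v uV vu by (auto simp: \<phi> good_def)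
  qed
qed

lemma val_phases:
  assumes "good A col" "card A \<le> (3 / 4) ^ j * real n" "val (phases V c Q C i (A, col)) = (A', col')"
  shows "good A' col' \<and> card A' \<le> (3 / 4) ^ (j + i) * real n"
  using assms
proof (induction i arbitrary: A col j)
  case (Suc i)
  obtain A1 col1 where 1: "val (phase V c Q C (A, col)) = (A1, col1)" by fastforce
  have "good A1 col1" "card A1 \<le> 3 / 4 * card A"
    using val_phase[OF Suc.prems(1) 1] by auto
  moreover have "3 / 4 * card A \<le> (3 / 4) ^ Suc j * real n" using Suc.prems(2) by simp
  ultimately show ?case
    using Suc.IH[of A1 col1 "Suc j"] Suc.prems(3) 1 by simp
qed simp

text \<open>The base is at least \<open>n / card A\<close>, hence at least
  \<open>(4 / 3) ^ j\<close>, and also at least 2; so its logarithm is at least the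
  denominator.\<close>

lemma digits_base_le:
  assumes "A \<subseteq> V" "A \<noteq> {}" "card A \<le> (3 / 4) ^ j * real n" "C \<ge> 1"
  shows "digits C (base V A) \<le> 1 + log 2 C / max 1 (2 / 5 * real j)"
proof -
  have B: "base V A \<ge> 2" using base_props(1)[OF assms(1,2)] .
  have pos: "card A > 0" using assms finite_V finite_subset card_gt_0_iff by blast
  have "real n / card A \<le> base V A"
    using real_divide_le_div_add_1[of n "card A"] by (simp add: base_def)
  moreover have "(4 / 3) ^ j \<le> real n / card A"
  proof -
    have "(4 / 3) ^ j * real (card A) \<le> (4 / 3) ^ j * ((3 / 4) ^ j * real n)"
      using assms(3) by (intro mult_left_mono) auto
    also have "\<dots> = real n" by (simp flip: power_mult_distrib mult.assoc)
    finally show ?thesis using pos by (simp add: field_simps)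
  qed
  ultimately have "(4 / 3 :: real) ^ j \<le> base V A" by linarith
  then have "log 2 ((4 / 3) ^ j) \<le> log 2 (base V A)" using B by (subst log_le_cancel_iff) auto
  then have "j * log 2 (4 / 3) \<le> log 2 (base V A)" by (simp add: log_nat_power)
  \<comment> \<open>This is \<open>(4 / 3) ^ 5 = 1024 / 243 \<ge> 4\<close> in logarithmic
    form.\<close>
  moreover have "2 / 5 \<le> log 2 (4 / 3 :: real)"
  proof -
    have "log 2 (2 ^ 2 :: real) \<le> log 2 ((4 / 3) ^ 5 :: real)"
      by (subst log_le_cancel_iff) (auto simp: power_divide)
    then have "real 2 * log 2 2 \<le> real 5 * log 2 (4 / 3 :: real)"
      by (simp only: log_nat_power[symmetric] zero_less_numeral zero_less_divide_iff simp_thms)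
    then show ?thesis by simp
  qed
  then have "real j * (2 / 5) \<le> j * log 2 (4 / 3)" by (intro mult_left_mono) auto
  moreover have "1 \<le> log 2 (base V A)" using B by (simp add: le_log_iff)
  ultimately have *: "max 1 (2 / 5 * real j) \<le> log 2 (base V A)" by simp
  have "log 2 C / log 2 (base V A) \<le> log 2 C / max 1 (2 / 5 * real j)"
    using * assms(4) by (intro divide_left_mono) auto
  then show ?thesis using digits_le[OF B assms(4)] by linarith
qed

lemma steps_phases:
  assumes "good A col" "card A \<le> (3 / 4) ^ j * real n" "C \<ge> 1"
  shows "steps (phases V c Q C i (A, col)) \<le>
    (\<Sum>k=j..<j + i. (1 + log 2 C / max 1 (2 / 5 * real k)) * (1 + 2 * c) + 1)"
  using assms(1,2)
proof (induction i arbitrary: A col j)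
  case (Suc i)
  let ?f = "\<lambda>k. (1 + log 2 C / max 1 (2 / 5 * real k)) * (1 + 2 * c) + 1"
  obtain A1 col1 where 1: "val (phase V c Q C (A, col)) = (A1, col1)" by fastforce
  have "good A1 col1" "card A1 \<le> 3 / 4 * card A"
    using val_phase[OF Suc.prems(1) 1] by auto
  moreover have "3 / 4 * card A \<le> (3 / 4) ^ Suc j * real n" using Suc.prems(2) by simp
  ultimately have "steps (phases V c Q C i (A1, col1)) \<le> (\<Sum>k=Suc j..<Suc j + i. ?f k)"
    using Suc.IH[of A1 col1 "Suc j"] by linarith
  moreover have "steps (phase V c Q C (A, col)) \<le> ?f j"
  proof (cases "A = {}")
    case True
    then show ?thesis using assms(3) by (simp add: steps_phase)
  next
    case False
    have "digits C (base V A) \<le> 1 + log 2 C / max 1 (2 / 5 * real j)"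
      using Suc.prems False assms(3) by (intro digits_base_le) (auto simp: good_def)
    then have "digits C (base V A) * real (1 + 2 * c) \<le> (1 + log 2 C / max 1 (2 / 5 * real j)) * (1 + 2 * c)"
      by (rule mult_right_mono) simp
    moreover have "steps (phase V c Q C (A, col)) = digits C (base V A) * (1 + 2 * c) + 1"
      using False by (simp add: steps_phase)
    ultimately show ?thesis by (simp only: of_nat_add of_nat_mult of_nat_1)
  qed
  moreover have "(\<Sum>k=j..<j + Suc i. ?f k) = ?f j + (\<Sum>k=Suc j..<Suc j + i. ?f k)"
    by (simp add: sum.atLeast_Suc_lessThan)
  moreover have "steps (phases V c Q C (Suc i) (A, col)) = steps (phase V c Q C (A, col)) + steps (phases V c Q C i (A1, col1))"
    by (simp add: 1)
  ultimately show ?case by (simp only: of_nat_add)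
qed simp

end

section \<open>Round complexity\<close>

text \<open>The harmonic sum is at most \<open>1 + ln P\<close>; scaled by 5/2, together with 1 for
  the term \<open>k = 0\<close>, this gives the constants.\<close>

lemma sum_inverse_max_le:
  assumes "P \<ge> 1"
  shows "(\<Sum>k<Suc P. 1 / max 1 (2 / 5 * real k)) \<le> 7 / 2 + 5 / 2 * ln (real P)"
  using assms
proof (induction P rule: dec_induct)
  case base
  then show ?case by simp
next
  case (step P)
  have pos: "real P > 0" using step by simp
  have "ln (real P / real (Suc P)) \<le> real P / real (Suc P) - 1"
    using pos by (intro ln_le_minus_one) auto
  also have "\<dots> = - (1 / real (Suc P))" by (simp add: field_simps)
  finally have "1 / real (Suc P) \<le> ln (real (Suc P)) - ln (real P)"
    using pos by (simp add: ln_div)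
  then have *: "5 / 2 * (1 / real (Suc P)) \<le> 5 / 2 * (ln (real (Suc P)) - ln (real P))"
    by (intro mult_left_mono) auto
  have "1 / max 1 (2 / 5 * real (Suc P)) \<le> 1 / (2 / 5 * real (Suc P))"
    by (intro divide_left_mono) auto
  also have "\<dots> = 5 / 2 * (1 / real (Suc P))" by simp
  also note *
  finally have "1 / max 1 (2 / 5 * real (Suc P)) \<le> 5 / 2 * (ln (real (Suc P)) - ln (real P))" .
  with step.IH have "(\<Sum>k<Suc P. 1 / max 1 (2 / 5 * real k)) + 1 / max 1 (2 / 5 * real (Suc P)) \<le>
      (7 / 2 + 5 / 2 * ln (real P)) + 5 / 2 * (ln (real (Suc P)) - ln (real P))"
    by (rule add_mono)
  also have "\<dots> = 7 / 2 + 5 / 2 * ln (real (Suc P))" by (simp add: algebra_simps)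
  finally show ?case by (subst sum.lessThan_Suc)
qed

section \<open>Estimates for the truncated logarithm and the total cost of the phases\<close>

lemma lg_ge_1: "1 \<le> lg x"
  by (simp add: lg_def)

lemma log_le_lg: "log 2 x \<le> lg x"
  by (simp add: lg_def)

lemma lg_mono:
  assumes "x \<le> y" "0 \<le> x"
  shows "lg x \<le> lg y"
proof (cases "x = 0")
  case False
  then have "log 2 x \<le> log 2 y" using assms by (subst log_le_cancel_iff) auto
  then show ?thesis by (simp add: lg_def)
\<comment> \<open>In HOL \<open>ln 0 = 0\<close>, hence \<open>lg 0 = 1\<close>, the least possible
  value.\<close>
qed (use lg_ge_1 in \<open>simp add: lg_def[of 0] log_def\<close>)

lemma ln_le_lg: "1 \<le> y \<Longrightarrow> ln y \<le> lg y"
proof -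
  assume "1 \<le> y"
  then have "ln y * ln 2 \<le> ln y * 1"
    using ln_le_minus_one[of 2] by (intro mult_left_mono) auto
  then have "ln y \<le> log 2 y" by (simp add: log_def field_simps)
  then show ?thesis using log_le_lg[of y] by linarith
qed

lemma phase_count_le: "phase_count (Suc \<Delta>) \<le> 12 * lg \<Delta>"
proof -
  have "real (floorlog 2 (2 * Suc \<Delta>)) \<le> log 2 (2 * Suc \<Delta>) + 1"
    by (simp add: floorlog_def)
  also have "log 2 (2 * Suc \<Delta>) = 1 + log 2 (Suc \<Delta>)"
    using log_mult[of 2 "real (Suc \<Delta>)" 2] by (simp add: algebra_simps)
  also have "log 2 (Suc \<Delta>) \<le> 1 + lg \<Delta>"
  proof (cases "\<Delta> = 0")
    case False
    then have "log 2 (Suc \<Delta>) \<le> log 2 (2 * real \<Delta>)" by (subst log_le_cancel_iff) auto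
    also have "\<dots> = 1 + log 2 \<Delta>" using False by (simp add: log_mult)
    finally show ?thesis using log_le_lg[of \<Delta>] by linarith
  qed (use lg_ge_1[of 0] in simp)
  finally show ?thesis using lg_ge_1[of \<Delta>] by (simp add: phase_count_def)
qed

text \<open>The fixed cost per phase sums to O(log \<Delta>), absorbed by \<open>x\<close>. The
  digits cost \<open>log C\<close> times a harmonic sum, which is logarithmic in the number of
  phases, hence O(log log \<Delta>).\<close>

lemma sum_phase_costs_le:
  fixes c C :: nat
  assumes "C \<ge> 1" and \<Delta>: "lg \<Delta> \<le> x" and C: "log 2 C \<le> x"
  shows "(\<Sum>k<phase_count (Suc \<Delta>). (1 + log 2 C / max 1 (2 / 5 * real k)) * (1 + 2 * c) + 1) \<le>
    (12 * (2 + 2 * c) + 34 * (1 + 2 * c)) * (lg (lg \<Delta>) * x)"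
proof -
  let ?P = "phase_count (Suc \<Delta>)" and ?y = "lg (lg \<Delta>)"
  have y: "1 \<le> ?y" and l: "1 \<le> lg \<Delta>" by (rule lg_ge_1)+
  have x: "1 \<le> x" using l \<Delta> by linarith
  have "floorlog 2 (2 * Suc \<Delta>) > 0" by (simp add: floorlog_def)
  then have P: "?P \<ge> 1" by (simp add: phase_count_def)
  have "ln (real ?P) \<le> ln (12 * lg \<Delta>)" using P phase_count_le[of \<Delta>] l by (subst ln_le_cancel_iff) auto
  also have "\<dots> = ln 12 + ln (lg \<Delta>)" using l by (simp add: ln_mult)
  also have "\<dots> \<le> 11 + ?y" using ln_le_minus_one[of 12] ln_le_lg[OF l] by simp
  finally have lnP: "ln (real ?P) \<le> 11 + ?y" .
  have "(\<Sum>k<?P. 1 / max 1 (2 / 5 * real k)) \<le> (\<Sum>k<Suc ?P. 1 / max 1 (2 / 5 * real k))"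
    by (subst sum.lessThan_Suc) simp
  \<comment> \<open>The constants are \<open>7 / 2 + 5 / 2 * (11 + y)\<close>, at most 33.5 times
    \<open>y\<close> because \<open>y \<ge> 1\<close>.\<close>
  also have "\<dots> \<le> 34 * ?y" using sum_inverse_max_le[OF P] lnP y by linarith
  finally have h: "(\<Sum>k<?P. 1 / max 1 (2 / 5 * real k)) \<le> 34 * ?y" .
  have "(\<Sum>k<?P. (1 + log 2 C / max 1 (2 / 5 * real k)) * (1 + 2 * c) + 1) =
      real ?P * real (2 + 2 * c) + real (1 + 2 * c) * (log 2 C * (\<Sum>k<?P. 1 / max 1 (2 / 5 * real k)))"
    by (simp add: sum.distrib sum_distrib_left sum_distrib_right algebra_simps)
  also have "\<dots> \<le> (12 * (?y * x)) * real (2 + 2 * c) + real (1 + 2 * c) * (x * (34 * ?y))"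
  proof (intro add_mono mult_right_mono mult_left_mono)
    have "1 * lg \<Delta> \<le> ?y * x" using y \<Delta> l by (intro mult_mono) auto
    then show "real ?P \<le> 12 * (?y * x)" using phase_count_le[of \<Delta>] by linarith
    show "log 2 C * (\<Sum>k<?P. 1 / max 1 (2 / 5 * real k)) \<le> x * (34 * ?y)"
      using C h x y by (intro mult_mono) (auto intro: sum_nonneg)
  qed auto
  also have "\<dots> = (12 * (2 + 2 * c) + 34 * (1 + 2 * c)) * (?y * x)" by (simp add: algebra_simps)
  finally show ?thesis .
qed

section \<open>Correctness and number of queries of the complete program\<close>

context coloring_clique
begin

text \<open>The summand 3 stands for the two initial broadcasts and the final
  \<open>gather\<close>.\<close>

lemma color_lists_correct:
  assumes C: "C = Suc (MAX v\<in>V. Max (snd (P v)))" and Z: "C \<le> Z" "D < Z" "n < Z"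
  defines "\<Delta> \<equiv> MAX v\<in>V. card (N v)" and "\<phi> \<equiv> val (color_lists c Q V)"
  shows "\<forall>v\<in>V. \<phi> v \<in> snd (P v) \<and> (\<forall>u\<in>N v. \<phi> u \<noteq> \<phi> v)"
    and "steps (color_lists c Q V) \<le> 3 +
      (\<Sum>k<phase_count (Suc \<Delta>). (1 + log 2 C / max 1 (2 / 5 * real k)) * (1 + 2 * c) + 1)"
proof -
  let ?i = "phase_count (Suc \<Delta>)"
  obtain A col where AC: "val (phases V c Q C ?i (V, \<lambda>_. 0)) = (A, col)" by fastforce
  have deg: "val (broadcast (\<lambda>v q. card (fst q))) v = card (N v)" if "v \<in> V" for v
  proof (rule val_broadcast[OF that])
    have "card (N v) \<le> n" using neighbors_subset[OF that] finite_V by (rule card_mono[rotated])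
    then show "card (N v) < Z" using Z by linarith
  qed
  have list: "val (broadcast (\<lambda>v q. Max (snd q))) v = Max (snd (P v))" if "v \<in> V" for v
  proof (rule val_broadcast[OF that])
    have "snd (P v) \<noteq> {}" using lists(2)[OF that] by auto
    then have "Max (snd (P v)) \<in> snd (P v)" using finite_list[OF that] by simp
    then show "Max (snd (P v)) < Z" using lists(1)[OF that] Z by auto
  qed
  have k: "Suc (Max (val (broadcast (\<lambda>v q. card (fst q))) ` V)) = Suc \<Delta>"
    using deg by (simp add: \<Delta>_def cong: image_cong)
  have C': "Suc (Max (val (broadcast (\<lambda>v q. Max (snd q))) ` V)) = C"
    using list by (simp add: C cong: image_cong)
  have start: "good V (\<lambda>_. 0)" by (simp add: good_def)
  have A: "good A col" "card A \<le> (3 / 4) ^ ?i * real n"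
    using val_phases[OF start _ AC, of 0] by auto
  have small: "card A * (2 * Suc \<Delta>) \<le> n"
  proof -
    have "real (card A) * real (2 * Suc \<Delta>) \<le> (3 / 4) ^ ?i * real n * real (2 * Suc \<Delta>)"
      using A(2) by (rule mult_right_mono) simp
    also have "\<dots> = ((3 / 4) ^ ?i * real (2 * Suc \<Delta>)) * real n" by (simp only: mult.assoc mult.left_commute mult.commute)
    also have "\<dots> \<le> 1 * real n" by (intro mult_right_mono phase_count_shrinks) simp
    finally show ?thesis by (simp only: mult_1 of_nat_le_iff flip: of_nat_mult)
  qed
  have "card (N v) < Suc \<Delta>" if "v \<in> V" for v
    using that finite_V by (simp add: \<Delta>_def less_Suc_eq_le)
  note finish = val_finish[OF A(1) small this Z(1,2)]
  have "\<phi> = val (finish V (Suc \<Delta>) A col)"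
    unfolding \<phi>_def color_lists_def value_of_bind Let_def k C' AC by simp
  then show "\<forall>v\<in>V. \<phi> v \<in> snd (P v) \<and> (\<forall>u\<in>N v. \<phi> u \<noteq> \<phi> v)" using finish by simp
  have "steps (color_lists c Q V) = 3 + steps (phases V c Q C ?i (V, \<lambda>_. 0))"
    unfolding color_lists_def steps_of_bind value_of_bind Let_def k C' AC by (simp add: finish_def)
  moreover have "steps (phases V c Q C ?i (V, \<lambda>_. 0)) \<le>
      (\<Sum>k=0..<0 + ?i. (1 + log 2 C / max 1 (2 / 5 * real k)) * (1 + 2 * c) + 1)"
    using C by (intro steps_phases start) auto
  ultimately show "steps (color_lists c Q V) \<le> 3 +
      (\<Sum>k<?i. (1 + log 2 C / max 1 (2 / 5 * real k)) * (1 + 2 * c) + 1)"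
    by (simp add: lessThan_atLeast0)
qed

end

section \<open>Choice of the constants for given identifier and color bounds\<close>

definition seed_exponent :: "nat \<Rightarrow> nat \<Rightarrow> nat" where
  "seed_exponent a p = 2 * (4 * p + a + 4)"

text \<open>It exceeds the exponent \<open>2 * c + 2 * p + 5\<close> of the largest vote total as
  well as those of identifiers, colors and thresholds, in base \<open>n + 1\<close>.\<close>

definition packet_exponent :: "nat \<Rightarrow> nat \<Rightarrow> nat" where
  "packet_exponent a p = 2 * p + 2 * seed_exponent a p + a + 6"

definition coloring_algorithm :: "nat \<Rightarrow> nat \<Rightarrow> (nat set, nat) algorithm" where
  "coloring_algorithm a p = compile (packet_exponent a p)
     (\<lambda>V. color_lists (seed_exponent a p) (8 * (card V + 1) ^ (2 * p)) V)"

lemma coloring_algorithm_correct: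
  assumes inst: "coloring_instance a p V E C L" and V: "V \<noteq> {}"
  defines "c \<equiv> seed_exponent a p"
  obtains T where "solves_within T (coloring_algorithm a p) V E C L"
    and "real T \<le> real (7 + 2 * (12 * (2 + 2 * c) + 34 * (1 + 2 * c))) * (lg (lg (max_deg V E)) * lg C)"
proof -
  let ?n = "card V" and ?N = "card V + 1"
  let ?P = "\<lambda>v. (neighbors E v, L v)"
  let ?Z = "2 ^ width (packet_exponent a p) V :: nat"
  \<comment> \<open>The factor 8 yields \<open>8 * C' \<le> Q\<close>, so the choice \<epsilon> = 1
    / Q also controls the error over all digits.\<close>
  define Q where "Q = 8 * ?N ^ (2 * p)"
  define C' where "C' = Suc (MAX v\<in>V. Max (L v))"
  define \<epsilon> where "\<epsilon> = 1 / real Q"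
  have fin: "finite V" and edges: "\<And>e. e \<in> E \<Longrightarrow> e \<subseteq> V \<and> card e = 2"
    and ids: "short_ids a V" and Cp: "C \<le> p * ?n ^ p"
    and inst_lists: "\<And>v. v \<in> V \<Longrightarrow> L v \<subseteq> {..<C}" "\<And>v. v \<in> V \<Longrightarrow> card (neighbors E v) + 1 \<le> card (L v)"
    using inst by (auto simp: coloring_instance_def simple_graph_def deg_def)
  have n: "?n > 0" using fin V by (simp add: card_gt_0_iff)
  have N2: "?N \<ge> 2" using n by simp
  have L: "finite (L v)" "L v \<noteq> {}" if "v \<in> V" for v
    using finite_subset[OF inst_lists(1)[OF that]] inst_lists(2)[OF that] by auto
  have Max_L: "Max (L v) < C" if "v \<in> V" for v
    using Max_in[OF L[OF that]] inst_lists(1)[OF that] by auto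
  have C'C: "C' \<le> C" unfolding C'_def using fin V Max_L by (simp add: Suc_le_eq)
  have CN: "C \<le> ?N ^ (2 * p)"
  proof -
    \<comment> \<open>The coefficient \<open>p\<close> of the polynomial bound is absorbed by
      doubling the exponent.\<close>
    have "p \<le> 2 ^ p" by (simp add: less_imp_le)
    also have "\<dots> \<le> ?N ^ p" using N2 by (intro power_mono) auto
    finally have "p * ?n ^ p \<le> ?N ^ p * ?N ^ p" by (intro mult_le_mono power_mono) auto
    then show ?thesis using Cp by (simp add: mult_2 power_add)
  qed
  have ZN: "?N ^ packet_exponent a p \<le> ?Z"
  proof -
    have "?n < 2 ^ floorlog 2 ?n" using floorlog_bounds[of ?n 2] n by simp
    then have "?N ^ packet_exponent a p \<le> (2 ^ floorlog 2 ?n) ^ packet_exponent a p"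
      by (intro power_mono) auto
    then show ?thesis by (simp add: width_def mult.commute flip: power_mult)
  qed
  have NZ: "?N ^ k < ?Z" if "k < packet_exponent a p" for k
    using power_strict_increasing[OF that, of ?N] N2 ZN by linarith
  have pow1: "m * m ^ (2 * c) * (m ^ 3 * m ^ (2 * p) * m) = m ^ (2 * c + 2 * p + 5)" for m :: nat
    by (simp add: power_add eval_nat_numeral)
  have pow2: "3 * (m ^ (2 * p) * (m * m ^ a)) * (8 * m ^ (2 * p)) = 24 * m ^ (4 * p + a + 1)" for m :: nat
  proof -
    have "4 * p + a + 1 = 2 * p + 2 * p + a + 1" by simp
    then show ?thesis by (simp only: power_add) simp
  qed
  have pow3: "m ^ 3 * m ^ (4 * p + a + 1) = m ^ (4 * p + a + 4)" for m :: nat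
    by (simp add: power_add eval_nat_numeral)
  have id_le: "v \<le> ?N ^ a" if "v \<in> V" for v
  proof -
    have "2 powr (real a * lg ?n) \<le> real ?N ^ a"
    proof -
      \<comment> \<open>The base \<open>n + 1\<close> instead of \<open>n\<close> covers
        \<open>n = 1\<close>, where \<open>lg 1 = 1\<close> and
        \<open>2 powr 1 = n + 1\<close>.\<close>
      have "2 powr lg ?n \<le> real ?N"
        using n by (cases "?n = 1") (auto simp: lg_def max_def)
      then have "(2 powr lg ?n) ^ a \<le> real ?N ^ a" by (intro power_mono) auto
      also have "(2 powr lg ?n) ^ a = (2 powr lg ?n) powr real a" by (simp add: powr_realpow)
      also have "\<dots> = 2 powr (real a * lg ?n)" by (simp only: powr_powr mult.commute)
      finally show ?thesis .
    qed
    then have "real v < real (?N ^ a)" using ids that by (fastforce simp: short_ids_def)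
    then have "v < ?N ^ a" by (simp only: of_nat_less_iff)
    then show ?thesis by simp
  qed
  interpret coloring_clique V ?P ?Z c Q "?N ^ a" C' \<epsilon>
  proof
    show "finite V" "V \<noteq> {}" by fact+
    show "fst (?P v) \<subseteq> V" for v using edges by (auto simp: neighbors_def)
    show "v \<notin> fst (?P v)" for v using edges[of "{v, v}"] by (auto simp: neighbors_def)
    show "u \<in> fst (?P v) \<longleftrightarrow> v \<in> fst (?P u)" for u v by (simp add: neighbors_def insert_commute)
    show "snd (?P v) \<subseteq> {..<C'}" if "v \<in> V" for v
    proof
      fix x assume "x \<in> snd (?P v)"
      then have "x \<le> Max (L v)" using L[OF that] by simp
      also have "\<dots> \<le> (MAX v\<in>V. Max (L v))" using fin that by simp
      finally show "x \<in> {..<C'}" by (simp add: C'_def)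
    qed
    show "card (fst (?P v)) + 1 \<le> card (snd (?P v))" if "v \<in> V" for v using inst_lists(2)[OF that] by simp
    show "v \<le> ?N ^ a" if "v \<in> V" for v by (rule id_le[OF that])
    show "1 < ?Z" using NZ[of 0] by (simp add: packet_exponent_def)
    have "?n ^ c \<le> ?N ^ c" by (intro power_mono) auto
    then show "?n ^ c < ?Z" using NZ[of c] by (simp add: packet_exponent_def c_def)
    have "?n * ?n ^ (2 * c) * (Q * ?n) \<le> ?N * ?N ^ (2 * c) * (Q * ?N)"
      by (intro mult_le_mono power_mono) auto
    also have "\<dots> \<le> ?N * ?N ^ (2 * c) * (?N ^ 3 * ?N ^ (2 * p) * ?N)"
      unfolding Q_def using power_mono[OF N2, of 3] by (intro mult_le_mono) auto
    also have "\<dots> = ?N ^ (2 * c + 2 * p + 5)" by (rule pow1)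
    also have "\<dots> < ?Z" by (rule NZ) (simp add: packet_exponent_def c_def)
    finally show "?n * ?n ^ (2 * c) * (Q * ?n) < ?Z" .
    show "Q > 0" by (simp add: Q_def)
    then show "1 / real Q \<le> \<epsilon>" "\<epsilon> \<le> 1" by (simp_all add: \<epsilon>_def)
    have "8 * C' \<le> Q" unfolding Q_def using C'C CN by simp
    then have "8 * real C' \<le> real Q" by linarith
    then show "8 * \<epsilon> * real C' \<le> 1" using \<open>Q > 0\<close> by (simp add: \<epsilon>_def field_simps)
    \<comment> \<open>Origin of \<open>seed_exponent\<close>: in base \<open>n + 1\<close>, the
      factors \<open>C'\<close> and \<open>Q\<close> contribute \<open>4 * p\<close>, the
      identifiers \<open>a\<close>, and the constants the remaining 4. The leading factor 2 replaces
      \<open>n + 1\<close> by \<open>n\<close>, as \<open>n + 1 \<le> n ^ 2\<close>.\<close>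
    show "3 * real (C' * (1 + 2 * ?N ^ a)) \<le> \<epsilon> * real (?n ^ c)" if n2: "?n \<ge> 2"
    proof -
      have "1 + 2 * ?N ^ a \<le> 3 * ?N ^ a" by simp
      also have "\<dots> \<le> ?N * ?N ^ a" using n2 by (intro mult_le_mono) auto
      finally have "3 * (C' * (1 + 2 * ?N ^ a)) * Q \<le> 3 * (?N ^ (2 * p) * (?N * ?N ^ a)) * (8 * ?N ^ (2 * p))"
        unfolding Q_def using C'C CN by (intro mult_le_mono) auto
      also have "\<dots> = 24 * ?N ^ (4 * p + a + 1)" by (rule pow2)
      also have "\<dots> \<le> ?N ^ 3 * ?N ^ (4 * p + a + 1)"
        using power_mono[of 3 ?N 3] n2 by (intro mult_le_mono) auto
      also have "\<dots> = ?N ^ (4 * p + a + 4)" by (rule pow3)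
      also have "\<dots> \<le> (?n ^ 2) ^ (4 * p + a + 4)"
      proof (rule power_mono)
        have "2 * ?n \<le> ?n * ?n" using n2 by (intro mult_le_mono) auto
        then show "?N \<le> ?n ^ 2" using n2 unfolding power2_eq_square by linarith
      qed simp
      also have "\<dots> = ?n ^ c" by (simp only: c_def seed_exponent_def power_mult)
      finally have "real (3 * (C' * (1 + 2 * ?N ^ a)) * Q) \<le> real (?n ^ c)" by (simp only: of_nat_le_iff)
      then show ?thesis using \<open>Q > 0\<close> by (simp add: \<epsilon>_def field_simps)
    qed
  qed
  let ?q = "color_lists c Q V"
  define \<Delta> where "\<Delta> = (MAX v\<in>V. card (neighbors E v))"
  have \<Delta>: "max_deg V E = \<Delta>"
    unfolding max_deg_def \<Delta>_def deg_def using fin V by simp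
  have "C' \<le> ?Z" "?N ^ a < ?Z" "?n < ?Z"
    using NZ[of "2 * p"] NZ[of a] NZ[of 1] C'C CN by (auto simp: packet_exponent_def)
  note correct = color_lists_correct[unfolded fst_conv snd_conv, OF C'_def this, folded \<Delta>_def]
  have alg: "coloring_algorithm a p = compile (packet_exponent a p) (\<lambda>V. color_lists c (8 * (card V + 1) ^ (2 * p)) V)"
    by (simp add: coloring_algorithm_def c_def)
  let ?T = "1 + 2 * steps ?q"
  have "solves_within ?T (coloring_algorithm a p) V E C L"
    unfolding solves_within_def
  proof (intro exI conjI)
    show "list_coloring V E C L (val ?q)"
      unfolding list_coloring_def
    proof (intro conjI ballI allI impI)
      fix v assume v: "v \<in> V"
      show "val ?q v \<in> L v" using correct(1) v by blast
      then show "val ?q v \<in> {..<C}" using inst_lists(1)[OF v] by blast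
    next
      fix u v assume "{u, v} \<in> E"
      then show "val ?q u \<noteq> val ?q v" using correct(1) edges by (fastforce simp: neighbors_def)
    qed
    show "\<forall>v\<in>V. \<exists>t\<le>?T. decides_after t (coloring_algorithm a p) V E L v (val ?q v)"
      using compile_decides[of _ V E L "packet_exponent a p" "\<lambda>V. color_lists c (8 * (card V + 1) ^ (2 * p)) V"]
      unfolding alg Q_def by blast
  qed
  moreover have "real ?T \<le> real (7 + 2 * (12 * (2 + 2 * c) + 34 * (1 + 2 * c))) * (lg (lg (max_deg V E)) * lg C)"
  proof -
    let ?x = "lg (lg \<Delta>) * lg C"
    obtain v where v: "v \<in> V" "card (neighbors E v) = \<Delta>"
    proof -
      have "\<Delta> \<in> (\<lambda>v. card (neighbors E v)) ` V"
        unfolding \<Delta>_def using fin V by (intro Max_in) auto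
      then show ?thesis using that by auto
    qed
    \<comment> \<open>A node of maximum degree has more than \<Delta> colors, so \<Delta> is at most
      \<open>C\<close>, as \<open>sum_phase_costs_le\<close> requires.\<close>
    have "card (L v) \<le> C" using card_mono[OF _ inst_lists(1)[OF v(1)]] by simp
    then have "\<Delta> \<le> C" using inst_lists(2)[OF v(1)] v(2) by linarith
    then have "lg \<Delta> \<le> lg C" by (intro lg_mono) auto
    moreover have "log 2 C' \<le> lg C"
      using C'C log_le_lg[of C'] lg_mono[of C' C] by simp
    ultimately have "(\<Sum>k<phase_count (Suc \<Delta>). (1 + log 2 C' / max 1 (2 / 5 * real k)) * (1 + 2 * c) + 1) \<le>
        (12 * (2 + 2 * c) + 34 * (1 + 2 * c)) * ?x"
      by (intro sum_phase_costs_le) (simp add: C'_def)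
    then have "steps ?q \<le> 3 + (12 * (2 + 2 * c) + 34 * (1 + 2 * c)) * ?x" using correct(2) by linarith
    \<comment> \<open>The additive 7, one discovery round and two rounds for each of 3 queries, is
      absorbed since the product of the logarithms is at least 1.\<close>
    moreover have "1 * 1 \<le> ?x" using lg_ge_1 by (intro mult_mono) (auto intro: order_trans[OF zero_le_one])
    ultimately show ?thesis unfolding \<Delta> by (simp add: algebra_simps)
  qed
  ultimately show ?thesis by (rule that)
qed

text \<open>In the constant, 1 covers the truncation of the logarithm, \<open>lg d\<close> the
  coefficient and \<open>d\<close> the exponent of the polynomial.\<close>

lemma lg_polynomial_le:
  fixes C \<Delta> d :: nat
  assumes "C \<le> d * max 1 \<Delta> ^ d"
  shows "lg C \<le> (1 + lg d + d) * lg \<Delta>"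
proof (cases "C = 0")
  case True
  have "1 * 1 \<le> (1 + lg d + d) * lg \<Delta>" using lg_ge_1[of d] lg_ge_1[of \<Delta>] by (intro mult_mono) auto
  then show ?thesis using True by (simp add: lg_def[of 0] log_def)
next
  case False
  have d: "d > 0"
  proof (rule ccontr)
    assume "\<not> d > 0"
    then show False using False assms by simp
  qed
  have m: "log 2 (max 1 \<Delta>) \<le> lg \<Delta>"
    by (cases "\<Delta> = 0") (auto simp: lg_def max_def)
  have "log 2 C \<le> log 2 (d * max 1 \<Delta> ^ d)"
    using False assms d by (subst log_le_cancel_iff) (auto simp flip: of_nat_power of_nat_mult)
  also have "\<dots> = log 2 d + d * log 2 (max 1 \<Delta>)"
    using d by (simp add: log_mult log_nat_power)
  also have "\<dots> \<le> lg d * lg \<Delta> + d * lg \<Delta>"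
  proof (intro add_mono mult_left_mono m)
    have "lg d * 1 \<le> lg d * lg \<Delta>" using lg_ge_1[of \<Delta>] lg_ge_1[of d] by (intro mult_left_mono) auto
    then show "log 2 d \<le> lg d * lg \<Delta>" using log_le_lg[of d] by linarith
  qed simp
  finally have *: "log 2 C \<le> lg d * lg \<Delta> + d * lg \<Delta>" .
  have "0 \<le> lg d * lg \<Delta>" "0 \<le> d * lg \<Delta>"
    using lg_ge_1[of \<Delta>] lg_ge_1[of d] by auto
  moreover have "(1 + lg d + d) * lg \<Delta> = lg \<Delta> + lg d * lg \<Delta> + d * lg \<Delta>"
    by (simp add: algebra_simps)
  ultimately show ?thesis
    using * lg_ge_1[of \<Delta>] unfolding lg_def[of C] by (intro max.boundedI) linarith+
qed

theorem theorem1p3: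
  fixes a p :: nat
  shows "\<exists>(A :: (nat set, nat) algorithm) (b :: nat).
    (\<forall>V E C L. coloring_instance a p V E C L \<longrightarrow> respects_bandwidth b A V E L) \<and>
    (\<exists>K::real. \<forall>V E C L. coloring_instance a p V E C L \<longrightarrow>
       (\<exists>T. solves_within T A V E C L \<and>
            real T \<le> K * (lg (lg (real (max_deg V E))) * lg (real C)))) \<and>
    (\<forall>d::nat. \<exists>K::real. \<forall>V E C L.
       coloring_instance a p V E C L \<and> C \<le> d * max 1 (max_deg V E) ^ d \<longrightarrow>
       (\<exists>T. solves_within T A V E C L \<and>
            real T \<le> K * (lg (real (max_deg V E)) * lg (lg (real (max_deg V E))))))"
proof -
  let ?A = "coloring_algorithm a p"
  obtain K :: real where K: "K \<ge> 0" "\<And>V E C L. coloring_instance a p V E C L \<Longrightarrow>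
      \<exists>T. solves_within T ?A V E C L \<and> real T \<le> K * (lg (lg (max_deg V E)) * lg C)"
  proof
    let ?c = "seed_exponent a p"
    let ?K = "real (7 + 2 * (12 * (2 + 2 * ?c) + 34 * (1 + 2 * ?c)))"
    show "?K \<ge> 0" by simp
    fix V E C L assume inst: "coloring_instance a p V E C L"
    show "\<exists>T. solves_within T ?A V E C L \<and> real T \<le> ?K * (lg (lg (max_deg V E)) * lg C)"
    \<comment> \<open>The maxima over \<open>V\<close> presuppose a node; the empty instance is
      solved in 0 rounds.\<close>
    proof (cases "V = {}")
      case True
      have "E = {}"
      proof -
        have "\<not> (e \<subseteq> {} \<and> card e = 2)" for e :: "nat set" by auto
        then show ?thesis using inst True by (auto simp: coloring_instance_def simple_graph_def)
      qed
      then have "solves_within 0 ?A V E C L"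
        using True by (simp add: solves_within_def list_coloring_def)
      moreover have "0 \<le> ?K * (lg (lg (max_deg V E)) * lg C)"
        using lg_ge_1[of C] lg_ge_1[of "lg (max_deg V E)"] by simp
      ultimately show ?thesis by force
    next
      case False
      show ?thesis using coloring_algorithm_correct[OF inst False] by metis
    qed
  qed
  show ?thesis
  proof (intro exI[of _ ?A] exI[of _ "2 * packet_exponent a p"] conjI allI impI)
    fix V E C L assume "coloring_instance a p V E C L"
    then show "respects_bandwidth (2 * packet_exponent a p) ?A V E L"
      unfolding coloring_algorithm_def
      by (intro compile_bandwidth) (simp add: coloring_instance_def simple_graph_def)
  next
    show "\<exists>K::real. \<forall>V E C L. coloring_instance a p V E C L \<longrightarrow>
       (\<exists>T. solves_within T ?A V E C L \<and> real T \<le> K * (lg (lg (real (max_deg V E))) * lg (real C)))"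
      using K(2) by blast
  next
    fix d :: nat
    have "\<exists>T. solves_within T ?A V E C L \<and>
        real T \<le> K * (1 + lg d + d) * (lg (max_deg V E) * lg (lg (max_deg V E)))"
      if inst: "coloring_instance a p V E C L" and C: "C \<le> d * max 1 (max_deg V E) ^ d" for V E C L
    proof -
      let ?\<Delta> = "max_deg V E"
      have "K * (lg (lg ?\<Delta>) * lg C) \<le> K * (lg (lg ?\<Delta>) * ((1 + lg d + d) * lg ?\<Delta>))"
        using K(1) lg_ge_1[of "lg ?\<Delta>"] lg_polynomial_le[OF C] by (intro mult_left_mono) auto
      also have "\<dots> = K * (1 + lg d + d) * (lg ?\<Delta> * lg (lg ?\<Delta>))" by (simp add: algebra_simps)
      finally show ?thesis using K(2)[OF inst] by (meson order_trans)
    qed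
    then show "\<exists>K::real. \<forall>V E C L.
       coloring_instance a p V E C L \<and> C \<le> d * max 1 (max_deg V E) ^ d \<longrightarrow>
       (\<exists>T. solves_within T ?A V E C L \<and>
            real T \<le> K * (lg (real (max_deg V E)) * lg (lg (real (max_deg V E)))))"
      by blast
  qed
qed

end
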